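(* Let $\mathcal T=(3,4,6,4)$ be the semi-regular edge-to-edge tessellation of the plane (the rhombitrihexagonal tiling) in which every vertex is surrounded, in cyclic order, by an equilateral triangle, a square, a regular hexagon and a square. Then its half-domination density satisfies $$\rho_{(3,4,6,4)}\le \frac{19}{30}.$$
   Context: The tessellation $\mathcal T=(3,4,6,4)$ is periodic: a minimal cluster consisting of one regular hexagon, three squares and two equilateral triangles (all with the same side length), translated by all integer combinations of two vectors $v_1,v_2$, tiles the plane edge-to-edge. For $m,n\in\mathbb N$, let $G_{\mathcal T,m,n}$ be the graph whose vertices are the tiles of the region formed by $m$ copies of the minimal cluster in the direction $v_1$ and $n$ copies in the direction $v_2$ (i.e. translates by $a v_1+b v_2$, $0\le a<m$, $0\le b<n$), two tiles being adjacent iff they share a common edge. For a vertex $v$ let $d(v)$ be its degree. A set $S$ of vertices is half-dependent if every $v\in S$ has at most $\lfloor d(v)/2\rfloor$ neighbors in $S$. Let $\rho_{\mathcal T,m,n}$ be the maximum cardinality of a half-dependent set in $G_{\mathcal T,m,n}$ divided by the number of vertices of $G_{\mathcal T,m,n}$, and define the half-domination density $\rho_{\mathcal T}=\limsup_{m,n\to\infty}\rho_{\mathcal T,m,n}$. *)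

theory Defs
  imports "HOL-Analysis.Analysis"
begin

section \<open>Half-dependent sets in finite graphs\<close>

definition neighbours :: "('a \<Rightarrow> 'a \<Rightarrow> bool) \<Rightarrow> 'a set \<Rightarrow> 'a \<Rightarrow> 'a set" where
  "neighbours adj V v = {w \<in> V. adj v w}"

definition degree_in :: "('a \<Rightarrow> 'a \<Rightarrow> bool) \<Rightarrow> 'a set \<Rightarrow> 'a \<Rightarrow> nat" where
  "degree_in adj V v = card (neighbours adj V v)"

definition half_dependent :: "('a \<Rightarrow> 'a \<Rightarrow> bool) \<Rightarrow> 'a set \<Rightarrow> 'a set \<Rightarrow> bool" where
  "half_dependent adj V S \<longleftrightarrow>
     S \<subseteq> V \<and> (\<forall>v\<in>S. card (neighbours adj V v \<inter> S) \<le> degree_in adj V v div 2)"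

definition half_dependence_ratio :: "('a \<Rightarrow> 'a \<Rightarrow> bool) \<Rightarrow> 'a set \<Rightarrow> real" where
  "half_dependence_ratio adj V = real (Max (card ` {S. half_dependent adj V S})) / real (card V)"

section \<open>The rhombitrihexagonal tiling\<close>

text \<open>
  Tiles are closed polygonal regions of the plane, all of side length 1. One hexagon is centred
  at the origin. Its corners are \<open>cis (k * pi / 3)\<close>, and \<open>cis (k * pi / 3 + pi / 6)\<close> is the outer
  unit normal of its side from corner \<open>k\<close> to corner \<open>k + 1\<close>. The tile \<open>square_tile k\<close> is the
  square erected on that side. At corner \<open>k\<close> the gap between \<open>square_tile (k - 1)\<close> and
  \<open>square_tile k\<close> is filled by \<open>triangle_tile k\<close>.
\<close>

definition hexagon_tile :: "complex set" where
  "hexagon_tile = convex hull ((\<lambda>k::nat. cis (k * pi / 3)) ` {..<6})"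

definition square_tile :: "nat \<Rightarrow> complex set" where
  "square_tile k = convex hull
     {cis (k * pi / 3), cis ((k + 1) * pi / 3),
      cis (k * pi / 3) + cis (k * pi / 3 + pi / 6),
      cis ((k + 1) * pi / 3) + cis (k * pi / 3 + pi / 6)}"

definition triangle_tile :: "nat \<Rightarrow> complex set" where
  "triangle_tile k = convex hull
     {cis (k * pi / 3),
      cis (k * pi / 3) + cis (k * pi / 3 + pi / 6),
      cis (k * pi / 3) + cis (k * pi / 3 - pi / 6)}"

text \<open>
  Opposite sides of a square belong to hexagons, so neighbouring hexagon centres are at distance
  \<open>sqrt 3 + 1\<close> (twice the apothem plus the side of a square).
\<close>

definition period1 :: complex where
  "period1 = of_real (1 + sqrt 3) * cis (pi / 6)"

definition period2 :: complex where
  "period2 = of_real (1 + sqrt 3) * cis (pi / 2)"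

text \<open>
  Every tile is a translate, by an integer combination of these two vectors, of the central hexagon
  or of one of the squares and triangles around it.
\<close>

definition periods :: "complex set" where
  "periods = {of_int a * period1 + of_int b * period2 | a b. True}"

definition hexagons :: "complex set set" where
  "hexagons = {(+) p ` hexagon_tile | p. p \<in> periods}"

definition squares :: "complex set set" where
  "squares = {(+) p ` square_tile k | p k. p \<in> periods \<and> k < 6}"

definition triangles :: "complex set set" where
  "triangles = {(+) p ` triangle_tile k | p k. p \<in> periods \<and> k < 6}"

definition tiles :: "complex set set" where
  "tiles = hexagons \<union> squares \<union> triangles"

definition adjacent_tiles :: "complex set \<Rightarrow> complex set \<Rightarrow> bool" where
  "adjacent_tiles P Q \<longleftrightarrow> P \<noteq> Q \<and> (\<exists>e. e edge_of P \<and> e edge_of Q)"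

section \<open>Minimal clusters and the half-domination density\<close>

text \<open>
  That the translates of the cluster tile the plane is the bijectivity below: every tile is obtained
  from exactly one tile of the cluster by exactly one integer combination of \<open>v1\<close> and \<open>v2\<close>. The
  choice of cluster and vectors is not unique, hence they are parameters of the density;
  \<open>minimal_cluster_standard\<close> below gives an example.
\<close>

definition minimal_cluster :: "complex set set \<Rightarrow> complex \<Rightarrow> complex \<Rightarrow> bool" where
  "minimal_cluster C v1 v2 \<longleftrightarrow>
     card (C \<inter> hexagons) = 1 \<and> card (C \<inter> squares) = 3 \<and> card (C \<inter> triangles) = 2 \<and>
     bij_betw (\<lambda>(P, a::int, b::int). (+) (of_int a * v1 + of_int b * v2) ` P)
       (C \<times> UNIV \<times> UNIV) tiles"

definition cluster_region ::
    "complex set set \<Rightarrow> complex \<Rightarrow> complex \<Rightarrow> nat \<Rightarrow> nat \<Rightarrow> complex set set" where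
  "cluster_region C v1 v2 m n =
     {(+) (of_nat a * v1 + of_nat b * v2) ` P | P a b. P \<in> C \<and> a < m \<and> b < n}"

definition half_domination_density :: "complex set set \<Rightarrow> complex \<Rightarrow> complex \<Rightarrow> ereal" where
  "half_domination_density C v1 v2 =
     Limsup (sequentially \<times>\<^sub>F sequentially)
       (\<lambda>(m, n). ereal (half_dependence_ratio adjacent_tiles (cluster_region C v1 v2 m n)))"

section \<open>Existence of a minimal cluster\<close>

lemma cis_values:
  "cis 0 = Complex 1 0"
  "cis (pi/6) = Complex (sqrt 3/2) (1/2)"
  "cis (-(pi/6)) = Complex (sqrt 3/2) (-(1/2))"
  "cis (pi/3) = Complex (1/2) (sqrt 3/2)"
  "cis (pi/2) = Complex 0 1"
  "cis (2*pi/3) = Complex (-(1/2)) (sqrt 3/2)"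
  "cis (5*pi/6) = Complex (-(sqrt 3/2)) (1/2)"
  "cis pi = Complex (-1) 0"
  "cis (7*pi/6) = Complex (-(sqrt 3/2)) (-(1/2))"
  "cis (4*pi/3) = Complex (-(1/2)) (-(sqrt 3/2))"
  "cis (3*pi/2) = Complex 0 (-1)"
  "cis (5*pi/3) = Complex (1/2) (-(sqrt 3/2))"
  "cis (11*pi/6) = Complex (sqrt 3/2) (-(1/2))"
  "cis (2*pi) = Complex 1 0"
proof -
  have sh: "cis (x + pi) = - cis x" for x by (simp add: complex_eq_iff)
  show 1: "cis 0 = Complex 1 0" by (simp add: complex_eq_iff)
  show 2: "cis (pi/6) = Complex (sqrt 3/2) (1/2)"
    by (simp add: complex_eq_iff cos_30 sin_30)
  show 3: "cis (-(pi/6)) = Complex (sqrt 3/2) (-(1/2))"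
    by (simp add: complex_eq_iff cos_30 sin_30)
  show 4: "cis (pi/3) = Complex (1/2) (sqrt 3/2)"
    by (simp add: complex_eq_iff cos_60 sin_60)
  show 5: "cis (pi/2) = Complex 0 1" by (simp add: complex_eq_iff)
  have "cis (-(pi/3)) = Complex (1/2) (-(sqrt 3/2))"
    by (simp add: complex_eq_iff cos_60 sin_60)
  with sh[of "-(pi/3)"] show 6: "cis (2*pi/3) = Complex (-(1/2)) (sqrt 3/2)"
    by (simp add: complex_eq_iff field_simps)
  from 3 sh[of "-(pi/6)"] show 7: "cis (5*pi/6) = Complex (-(sqrt 3/2)) (1/2)"
    by (simp add: complex_eq_iff field_simps)
  show 8: "cis pi = Complex (-1) 0" by (simp add: complex_eq_iff)
  from 2 sh[of "pi/6"] show 9: "cis (7*pi/6) = Complex (-(sqrt 3/2)) (-(1/2))"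
    by (simp add: complex_eq_iff field_simps)
  from 4 sh[of "pi/3"] show "cis (4*pi/3) = Complex (-(1/2)) (-(sqrt 3/2))"
    by (simp add: complex_eq_iff field_simps)
  from 5 sh[of "pi/2"] show "cis (3*pi/2) = Complex 0 (-1)"
    by (simp add: complex_eq_iff field_simps)
  from 6 sh[of "2*pi/3"] show "cis (5*pi/3) = Complex (1/2) (-(sqrt 3/2))"
    by (simp add: complex_eq_iff field_simps)
  from 7 sh[of "5*pi/6"] show "cis (11*pi/6) = Complex (sqrt 3/2) (-(1/2))"
    by (simp add: complex_eq_iff field_simps)
  show "cis (2*pi) = Complex 1 0" by (simp add: complex_eq_iff)
qed

lemma hexagon_tile_eq:
  "hexagon_tile = convex hull {Complex 1 0, Complex (1/2) (sqrt 3/2), Complex (-(1/2)) (sqrt 3/2),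
     Complex (-1) 0, Complex (-(1/2)) (-(sqrt 3/2)), Complex (1/2) (-(sqrt 3/2))}"
proof -
  have *: "{..<6} = {0, 1, 2, 3, 4, 5::nat}" by auto
  show ?thesis
    unfolding hexagon_tile_def * using cis_values by simp
qed

lemma square_tile_eqI:
  assumes "real k * pi / 3 = x" "(real k + 1) * pi / 3 = y" "real k * pi / 3 + pi / 6 = z"
    and "cis x = p" "cis y = q" "cis z = r"
  shows "square_tile k = convex hull {p, q, p + r, q + r}"
  unfolding square_tile_def using assms by simp

lemma triangle_tile_eqI:
  assumes "real k * pi / 3 = x" "real k * pi / 3 + pi / 6 = y" "real k * pi / 3 - pi / 6 = z"
    and "cis x = p" "cis y = q" "cis z = r"
  shows "triangle_tile k = convex hull {p, p + q, p + r}"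
  unfolding triangle_tile_def using assms by simp

lemma square_tile_eq:
  "square_tile 0 = convex hull {Complex 1 0, Complex (1/2) (sqrt 3/2),
     Complex 1 0 + Complex (sqrt 3/2) (1/2), Complex (1/2) (sqrt 3/2) + Complex (sqrt 3/2) (1/2)}"
  "square_tile 1 = convex hull {Complex (1/2) (sqrt 3/2), Complex (-(1/2)) (sqrt 3/2),
     Complex (1/2) (sqrt 3/2) + Complex 0 1, Complex (-(1/2)) (sqrt 3/2) + Complex 0 1}"
  "square_tile 2 = convex hull {Complex (-(1/2)) (sqrt 3/2), Complex (-1) 0,
     Complex (-(1/2)) (sqrt 3/2) + Complex (-(sqrt 3/2)) (1/2),
     Complex (-1) 0 + Complex (-(sqrt 3/2)) (1/2)}"
  "square_tile 3 = convex hull {Complex (-1) 0, Complex (-(1/2)) (-(sqrt 3/2)),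
     Complex (-1) 0 + Complex (-(sqrt 3/2)) (-(1/2)),
     Complex (-(1/2)) (-(sqrt 3/2)) + Complex (-(sqrt 3/2)) (-(1/2))}"
  "square_tile 4 = convex hull {Complex (-(1/2)) (-(sqrt 3/2)), Complex (1/2) (-(sqrt 3/2)),
     Complex (-(1/2)) (-(sqrt 3/2)) + Complex 0 (-1), Complex (1/2) (-(sqrt 3/2)) + Complex 0 (-1)}"
  "square_tile 5 = convex hull {Complex (1/2) (-(sqrt 3/2)), Complex 1 0,
     Complex (1/2) (-(sqrt 3/2)) + Complex (sqrt 3/2) (-(1/2)),
     Complex 1 0 + Complex (sqrt 3/2) (-(1/2))}"
  subgoal by (rule square_tile_eqI[OF _ _ _ cis_values(1,4,2)]) (simp_all add: field_simps)
  subgoal by (rule square_tile_eqI[OF _ _ _ cis_values(4,6,5)]) (simp_all add: field_simps)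
  subgoal by (rule square_tile_eqI[OF _ _ _ cis_values(6,8,7)]) (simp_all add: field_simps)
  subgoal by (rule square_tile_eqI[OF _ _ _ cis_values(8,10,9)]) (simp_all add: field_simps)
  subgoal by (rule square_tile_eqI[OF _ _ _ cis_values(10,12,11)]) (simp_all add: field_simps)
  subgoal by (rule square_tile_eqI[OF _ _ _ cis_values(12,14,13)]) (simp_all add: field_simps)
  done

lemma triangle_tile_eq:
  "triangle_tile 0 = convex hull {Complex 1 0,
     Complex 1 0 + Complex (sqrt 3/2) (1/2), Complex 1 0 + Complex (sqrt 3/2) (-(1/2))}"
  "triangle_tile 1 = convex hull {Complex (1/2) (sqrt 3/2),
     Complex (1/2) (sqrt 3/2) + Complex 0 1, Complex (1/2) (sqrt 3/2) + Complex (sqrt 3/2) (1/2)}"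
  "triangle_tile 2 = convex hull {Complex (-(1/2)) (sqrt 3/2),
     Complex (-(1/2)) (sqrt 3/2) + Complex (-(sqrt 3/2)) (1/2),
     Complex (-(1/2)) (sqrt 3/2) + Complex 0 1}"
  "triangle_tile 3 = convex hull {Complex (-1) 0,
     Complex (-1) 0 + Complex (-(sqrt 3/2)) (-(1/2)), Complex (-1) 0 + Complex (-(sqrt 3/2)) (1/2)}"
  "triangle_tile 4 = convex hull {Complex (-(1/2)) (-(sqrt 3/2)),
     Complex (-(1/2)) (-(sqrt 3/2)) + Complex 0 (-1),
     Complex (-(1/2)) (-(sqrt 3/2)) + Complex (-(sqrt 3/2)) (-(1/2))}"
  "triangle_tile 5 = convex hull {Complex (1/2) (-(sqrt 3/2)),
     Complex (1/2) (-(sqrt 3/2)) + Complex (sqrt 3/2) (-(1/2)),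
     Complex (1/2) (-(sqrt 3/2)) + Complex 0 (-1)}"
  subgoal by (rule triangle_tile_eqI[OF _ _ _ cis_values(1,2,3)]) (simp_all add: field_simps)
  subgoal by (rule triangle_tile_eqI[OF _ _ _ cis_values(4,5,2)]) (simp_all add: field_simps)
  subgoal by (rule triangle_tile_eqI[OF _ _ _ cis_values(6,7,5)]) (simp_all add: field_simps)
  subgoal by (rule triangle_tile_eqI[OF _ _ _ cis_values(8,9,7)]) (simp_all add: field_simps)
  subgoal by (rule triangle_tile_eqI[OF _ _ _ cis_values(10,11,9)]) (simp_all add: field_simps)
  subgoal by (rule triangle_tile_eqI[OF _ _ _ cis_values(12,13,11)]) (simp_all add: field_simps)
  done

lemma period_eq:
  "period1 = Complex ((sqrt 3 + 3)/2) ((1 + sqrt 3)/2)"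
  "period2 = Complex 0 (1 + sqrt 3)"
  unfolding period1_def period2_def cis_values
  by (simp_all add: complex_eq_iff field_simps)

lemma translate_hull_eqI:
  fixes V W :: "'a::real_vector set"
  assumes "W = (+) p ` V"
  shows "convex hull W = (+) p ` (convex hull V)"
  unfolding assms by (rule convex_hull_translation)

lemma tile_translates:
  "square_tile 3 = (+) (- period1) ` square_tile 0"
  "square_tile 4 = (+) (- period2) ` square_tile 1"
  "square_tile 5 = (+) (period1 - period2) ` square_tile 2"
  "triangle_tile 0 = (+) (period1 - period2) ` triangle_tile 2"
  "triangle_tile 3 = (+) (- period1) ` triangle_tile 1"
  "triangle_tile 4 = (+) (- period2) ` triangle_tile 2"
  "triangle_tile 5 = (+) (- period2) ` triangle_tile 1"
  unfolding square_tile_eq triangle_tile_eq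
  by (rule translate_hull_eqI, rule equalityI;
      simp add: period_eq complex_eq_iff field_simps)+

lemma extreme_points_hull_sphere:
  fixes V :: "'a::euclidean_space set"
  assumes "V \<subseteq> sphere c r"
  shows "{x. x extreme_point_of (convex hull V)} = V"
proof
  show "{x. x extreme_point_of (convex hull V)} \<subseteq> V"
    by (rule extreme_points_of_convex_hull)
  have hull: "convex hull V \<subseteq> cball c r"
    using assms by (intro hull_minimal) auto
  show "V \<subseteq> {x. x extreme_point_of (convex hull V)}"
  proof safe
    fix x assume x: "x \<in> V"
    have "x \<notin> open_segment a b" if "a \<in> convex hull V" "b \<in> convex hull V" for a b
    proof
      assume "x \<in> open_segment a b"
      then have "dist c x < dist c a \<or> dist c x < dist c b"
        by (rule dist_decreases_open_segment)
      then show False using that hull x assms by force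
    qed
    then show "x extreme_point_of (convex hull V)"
      using x by (auto simp: extreme_point_of_def hull_inc)
  qed
qed

definition corners :: "complex set \<Rightarrow> complex set" where
  "corners P = {x. x extreme_point_of P}"

definition centroid :: "complex set \<Rightarrow> complex" where
  "centroid P = \<Sum>(corners P) / of_nat (card (corners P))"

lemma corners_translate: "corners ((+) p ` P) = (+) p ` corners P"
  unfolding corners_def by (rule extreme_points_of_translation)

lemma card_corners_translate: "card (corners ((+) p ` P)) = card (corners P)"
  by (simp add: corners_translate card_image)

lemma centroid_translate:
  assumes "card (corners P) > 0"
  shows "centroid ((+) p ` P) = p + centroid P"
proof -
  have "\<Sum>((+) p ` corners P) = (\<Sum>x\<in>corners P. p + x)"
    by (subst sum.reindex) (auto simp: o_def)
  then show ?thesis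
    using assms unfolding centroid_def card_corners_translate
    unfolding corners_translate by (simp add: sum.distrib add_divide_distrib)
qed

lemma corners_hull:
  assumes "V \<subseteq> sphere c r"
  shows "corners (convex hull V) = V"
  unfolding corners_def by (rule extreme_points_hull_sphere[OF assms])

lemma corners_hexagon_tile:
  "corners hexagon_tile = {Complex 1 0, Complex (1/2) (sqrt 3/2), Complex (-(1/2)) (sqrt 3/2),
     Complex (-1) 0, Complex (-(1/2)) (-(sqrt 3/2)), Complex (1/2) (-(sqrt 3/2))}"
  unfolding hexagon_tile_eq
  by (rule corners_hull[where c = 0 and r = 1])
     (simp add: cmod_def dist_norm power2_eq_square field_simps)

lemma hexagon_tile_corners:
  "card (corners hexagon_tile) = 6" "centroid hexagon_tile = 0"
  unfolding centroid_def corners_hexagon_tile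
  by (simp_all add: complex_eq_iff)

lemma corners_square_tile:
  "corners (square_tile 0) = {Complex 1 0, Complex (1/2) (sqrt 3/2),
     Complex 1 0 + Complex (sqrt 3/2) (1/2), Complex (1/2) (sqrt 3/2) + Complex (sqrt 3/2) (1/2)}"
  "corners (square_tile 1) = {Complex (1/2) (sqrt 3/2), Complex (-(1/2)) (sqrt 3/2),
     Complex (1/2) (sqrt 3/2) + Complex 0 1, Complex (-(1/2)) (sqrt 3/2) + Complex 0 1}"
  "corners (square_tile 2) = {Complex (-(1/2)) (sqrt 3/2), Complex (-1) 0,
     Complex (-(1/2)) (sqrt 3/2) + Complex (-(sqrt 3/2)) (1/2),
     Complex (-1) 0 + Complex (-(sqrt 3/2)) (1/2)}"
  unfolding square_tile_eq
  subgoal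
    by (rule corners_hull[where c = "period1 / 2" and r = "sqrt (1/2)"])
       (simp add: period_eq cmod_def dist_norm power2_eq_square field_simps)
  subgoal
    by (rule corners_hull[where c = "period2 / 2" and r = "sqrt (1/2)"])
       (simp add: period_eq cmod_def dist_norm power2_eq_square field_simps)
  subgoal
    by (rule corners_hull[where c = "(period2 - period1) / 2" and r = "sqrt (1/2)"])
       (simp add: period_eq cmod_def dist_norm power2_eq_square field_simps)
  done

lemma square_tile_corners:
  "card (corners (square_tile 0)) = 4" "centroid (square_tile 0) = period1 / 2"
  "card (corners (square_tile 1)) = 4" "centroid (square_tile 1) = period2 / 2"
  "card (corners (square_tile 2)) = 4" "centroid (square_tile 2) = (period2 - period1) / 2"
  unfolding centroid_def corners_square_tile
  by (simp_all add: complex_eq_iff period_eq field_simps)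

lemma corners_triangle_tile:
  "corners (triangle_tile 1) = {Complex (1/2) (sqrt 3/2),
     Complex (1/2) (sqrt 3/2) + Complex 0 1, Complex (1/2) (sqrt 3/2) + Complex (sqrt 3/2) (1/2)}"
  "corners (triangle_tile 2) = {Complex (-(1/2)) (sqrt 3/2),
     Complex (-(1/2)) (sqrt 3/2) + Complex (-(sqrt 3/2)) (1/2),
     Complex (-(1/2)) (sqrt 3/2) + Complex 0 1}"
  unfolding triangle_tile_eq
  subgoal
    by (rule corners_hull[where c = "(period1 + period2) / 3" and r = "sqrt (1/3)"])
       (simp add: period_eq cmod_def dist_norm power2_eq_square field_simps)
  subgoal
    by (rule corners_hull[where c = "(2 * period2 - period1) / 3" and r = "sqrt (1/3)"])
       (simp add: period_eq cmod_def dist_norm power2_eq_square field_simps)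
  done

lemma triangle_tile_corners:
  "card (corners (triangle_tile 1)) = 3" "centroid (triangle_tile 1) = (period1 + period2) / 3"
  "card (corners (triangle_tile 2)) = 3" "centroid (triangle_tile 2) = (2 * period2 - period1) / 3"
  unfolding centroid_def corners_triangle_tile
  by (simp_all add: complex_eq_iff period_eq field_simps)

lemma self_translate: "P = (+) (0::complex) ` P"
  by simp

lemma less_6_cases: "k < 6 \<Longrightarrow> k \<in> {0, 1, 2, 3, 4, 5::nat}"
  by auto

lemma periods_add: "p \<in> periods \<Longrightarrow> q \<in> periods \<Longrightarrow> p + q \<in> periods"
proof -
  assume "p \<in> periods" "q \<in> periods"
  then obtain a b c d :: int where
    "p = of_int a * period1 + of_int b * period2" "q = of_int c * period1 + of_int d * period2"
    unfolding periods_def by blast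
  then have "p + q = of_int (a + c) * period1 + of_int (b + d) * period2"
    by (simp add: algebra_simps)
  then show ?thesis unfolding periods_def by blast
qed

lemma periods_intro:
  "0 \<in> periods" "- period1 \<in> periods" "- period2 \<in> periods" "period1 - period2 \<in> periods"
proof -
  have "of_int a * period1 + of_int b * period2 \<in> periods" for a b
    unfolding periods_def by blast
  from this[of 0 0] this[of "-1" 0] this[of 0 "-1"] this[of 1 "-1"]
  show "0 \<in> periods" "- period1 \<in> periods" "- period2 \<in> periods" "period1 - period2 \<in> periods"
    by simp_all
qed

lemma squares_eq:
  "squares = {(+) p ` P | p P. p \<in> periods \<and> P \<in> {square_tile 0, square_tile 1, square_tile 2}}"
    (is "_ = ?R")
proof
  have "(+) p ` square_tile k \<in> squares" if "p \<in> periods" "k < 6" for p k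
    using that unfolding squares_def by blast
  from this[of _ 0] this[of _ 1] this[of _ 2] show "?R \<subseteq> squares"
    by auto
  show "squares \<subseteq> ?R"
  proof
    fix Q assume "Q \<in> squares"
    then obtain p k where Q: "Q = (+) p ` square_tile k" and p: "p \<in> periods" and "k < 6"
      unfolding squares_def by blast
    have "\<exists>q\<in>periods. \<exists>P\<in>{square_tile 0, square_tile 1, square_tile 2}. square_tile k = (+) q ` P"
      using less_6_cases[OF \<open>k < 6\<close>] periods_intro
      by (elim insertE emptyE) (use self_translate tile_translates in blast)+
    then obtain q P where "q \<in> periods" "P \<in> {square_tile 0, square_tile 1, square_tile 2}"
      "square_tile k = (+) q ` P" by blast
    then have "Q = (+) (p + q) ` P" "p + q \<in> periods"
      using Q p periods_add by (auto simp: image_image add.assoc)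
    then show "Q \<in> ?R" using \<open>P \<in> _\<close> by blast
  qed
qed

lemma triangles_eq:
  "triangles = {(+) p ` P | p P. p \<in> periods \<and> P \<in> {triangle_tile 1, triangle_tile 2}}"
    (is "_ = ?R")
proof
  have "(+) p ` triangle_tile k \<in> triangles" if "p \<in> periods" "k < 6" for p k
    using that unfolding triangles_def by blast
  from this[of _ 1] this[of _ 2] show "?R \<subseteq> triangles"
    by auto
  show "triangles \<subseteq> ?R"
  proof
    fix Q assume "Q \<in> triangles"
    then obtain p k where Q: "Q = (+) p ` triangle_tile k" and p: "p \<in> periods" and "k < 6"
      unfolding triangles_def by blast
    have "\<exists>q\<in>periods. \<exists>P\<in>{triangle_tile 1, triangle_tile 2}. triangle_tile k = (+) q ` P"
      using less_6_cases[OF \<open>k < 6\<close>] periods_intro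
      by (elim insertE emptyE) (use self_translate tile_translates in blast)+
    then obtain q P where "q \<in> periods" "P \<in> {triangle_tile 1, triangle_tile 2}"
      "triangle_tile k = (+) q ` P" by blast
    then have "Q = (+) (p + q) ` P" "p + q \<in> periods"
      using Q p periods_add by (auto simp: image_image add.assoc)
    then show "Q \<in> ?R" using \<open>P \<in> _\<close> by blast
  qed
qed

lemma tile_cards:
  "P \<in> hexagons \<Longrightarrow> card (corners P) = 6"
  "P \<in> squares \<Longrightarrow> card (corners P) = 4"
  "P \<in> triangles \<Longrightarrow> card (corners P) = 3"
  unfolding hexagons_def squares_eq triangles_eq
  by (auto simp: card_corners_translate hexagon_tile_corners square_tile_corners
      triangle_tile_corners simp del: One_nat_def)

lemma period_coords:
  fixes x y x' y' :: real
  assumes "of_real x * period1 + of_real y * period2 = of_real x' * period1 + of_real y' * period2"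
  shows "x = x' \<and> y = y'"
proof -
  have s: "sqrt 3 > 0" by simp
  have "x * ((sqrt 3 + 3)/2) = x' * ((sqrt 3 + 3)/2)"
    using arg_cong[OF assms, of Re] by (simp add: period_eq)
  then have "x = x'" using s by auto
  moreover have "y * (1 + sqrt 3) = y' * (1 + sqrt 3)"
    using arg_cong[OF assms, of Im] \<open>x = x'\<close> by (simp add: period_eq)
  then have "y = y'" using s by auto
  ultimately show ?thesis by simp
qed

definition standard_cluster :: "complex set set" where
  "standard_cluster = {hexagon_tile, square_tile 0, square_tile 1, square_tile 2,
     triangle_tile 1, triangle_tile 2}"

lemma standard_cluster_centroid:
  assumes "P \<in> standard_cluster"
  obtains i j :: int where "centroid P = (of_int i * period1 + of_int j * period2) / 6"
    and "(P, i, j) \<in> {(hexagon_tile, 0, 0), (square_tile 0, 3, 0), (square_tile 1, 0, 3),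
           (square_tile 2, -3, 3), (triangle_tile 1, 2, 2), (triangle_tile 2, -2, 4)}"
    and "card (corners P) > 0"
proof -
  have c: "centroid hexagon_tile = (of_int 0 * period1 + of_int 0 * period2) / 6"
    "centroid (square_tile 0) = (of_int 3 * period1 + of_int 0 * period2) / 6"
    "centroid (square_tile 1) = (of_int 0 * period1 + of_int 3 * period2) / 6"
    "centroid (square_tile 2) = (of_int (-3) * period1 + of_int 3 * period2) / 6"
    "centroid (triangle_tile 1) = (of_int 2 * period1 + of_int 2 * period2) / 6"
    "centroid (triangle_tile 2) = (of_int (-2) * period1 + of_int 4 * period2) / 6"
    unfolding hexagon_tile_corners square_tile_corners triangle_tile_corners
    by (simp_all add: field_simps)
  have d: "card (corners P) > 0"
    using assms unfolding standard_cluster_def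
    by (auto simp: hexagon_tile_corners square_tile_corners triangle_tile_corners
        simp del: One_nat_def)
  from assms consider "P = hexagon_tile" | "P = square_tile 0" | "P = square_tile 1"
    | "P = square_tile 2" | "P = triangle_tile 1" | "P = triangle_tile 2"
    unfolding standard_cluster_def by blast
  then show ?thesis
  proof cases
    case 1
    then show ?thesis using that[of 0 0] c(1) d by simp
  next
    case 2
    then show ?thesis using that[of 3 0] c(2) d by simp
  next
    case 3
    then show ?thesis using that[of 0 3] c(3) d by simp
  next
    case 4
    then show ?thesis using that[of "-3" 3] c(4) d by simp
  next
    case 5
    then show ?thesis using that[of 2 2] c(5) d by simp
  next
    case 6
    then show ?thesis using that[of "-2" 4] c(6) d by simp
  qed
qed

lemma standard_cluster_inj:
  assumes P: "P \<in> standard_cluster" and Q: "Q \<in> standard_cluster"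
    and eq: "(+) (of_int a * period1 + of_int b * period2) ` P =
             (+) (of_int a' * period1 + of_int b' * period2) ` Q"
  shows "P = Q \<and> a = a' \<and> b = b'"
proof -
  obtain i j :: int where P': "centroid P = (of_int i * period1 + of_int j * period2) / 6"
    "(P, i, j) \<in> {(hexagon_tile, 0, 0), (square_tile 0, 3, 0), (square_tile 1, 0, 3),
           (square_tile 2, -3, 3), (triangle_tile 1, 2, 2), (triangle_tile 2, -2, 4)}"
    "card (corners P) > 0" using standard_cluster_centroid[OF P] .
  obtain k l :: int where Q': "centroid Q = (of_int k * period1 + of_int l * period2) / 6"
    "(Q, k, l) \<in> {(hexagon_tile, 0, 0), (square_tile 0, 3, 0), (square_tile 1, 0, 3),
           (square_tile 2, -3, 3), (triangle_tile 1, 2, 2), (triangle_tile 2, -2, 4)}"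
    "card (corners Q) > 0" using standard_cluster_centroid[OF Q] .
  have "of_int a * period1 + of_int b * period2 + centroid P =
        of_int a' * period1 + of_int b' * period2 + centroid Q"
    using arg_cong[OF eq, of centroid] by (simp add: centroid_translate P'(3) Q'(3))
  moreover have six: "6 * centroid P = of_int i * period1 + of_int j * period2"
    "6 * centroid Q = of_int k * period1 + of_int l * period2"
    unfolding P'(1) Q'(1) by simp_all
  ultimately have "6 * (of_int a * period1 + of_int b * period2) + 6 * centroid P =
      6 * (of_int a' * period1 + of_int b' * period2) + 6 * centroid Q"
    by (metis distrib_left)
  then have "of_real (of_int (6 * a + i)) * period1 + of_real (of_int (6 * b + j)) * period2 =
        of_real (of_int (6 * a' + k)) * period1 + of_real (of_int (6 * b' + l)) * period2"
    unfolding six by (simp add: algebra_simps)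
  then have "real_of_int (6 * a + i) = real_of_int (6 * a' + k) \<and>
             real_of_int (6 * b + j) = real_of_int (6 * b' + l)"
    by (rule period_coords)
  then have *: "6 * a + i = 6 * a' + k" "6 * b + j = 6 * b' + l"
    by linarith+
  have "i mod 6 = k mod 6" "j mod 6 = l mod 6"
    using * by presburger+
  then have "P = Q \<and> i = k \<and> j = l"
    using P'(2) Q'(2) by (elim insertE emptyE; simp)
  then show ?thesis using * by simp
qed

lemma standard_cluster_distinct:
  "distinct [square_tile 0, square_tile 1, square_tile 2]" "triangle_tile 1 \<noteq> triangle_tile 2"
proof -
  have ne: "P \<noteq> Q" if "centroid P = of_real x * period1 + of_real y * period2"
    "centroid Q = of_real x' * period1 + of_real y' * period2" "(x, y) \<noteq> (x', y')" for P Q x y x' y'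
    using that period_coords by force
  have c: "centroid (square_tile 0) = of_real (1/2) * period1 + of_real 0 * period2"
    "centroid (square_tile 1) = of_real 0 * period1 + of_real (1/2) * period2"
    "centroid (square_tile 2) = of_real (-1/2) * period1 + of_real (1/2) * period2"
    "centroid (triangle_tile 1) = of_real (1/3) * period1 + of_real (1/3) * period2"
    "centroid (triangle_tile 2) = of_real (-1/3) * period1 + of_real (2/3) * period2"
    unfolding square_tile_corners triangle_tile_corners by (simp_all add: field_simps)
  show "distinct [square_tile 0, square_tile 1, square_tile 2]"
    using ne[OF c(1,2)] ne[OF c(1,3)] ne[OF c(2,3)] by simp
  show "triangle_tile 1 \<noteq> triangle_tile 2"
    using ne[OF c(4,5)] by simp
qed

theorem minimal_cluster_standard: "minimal_cluster standard_cluster period1 period2"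
proof -
  have hex: "hexagon_tile \<in> hexagons"
    unfolding hexagons_def using periods_intro(1) self_translate by blast
  have sq: "{square_tile 0, square_tile 1, square_tile 2} \<subseteq> squares"
    unfolding squares_eq using periods_intro(1) self_translate by blast
  have tri: "{triangle_tile 1, triangle_tile 2} \<subseteq> triangles"
    unfolding triangles_eq using periods_intro(1) self_translate by blast
  have disj: "hexagons \<inter> squares = {}" "hexagons \<inter> triangles = {}" "squares \<inter> triangles = {}"
    by (auto dest!: tile_cards)
  have "standard_cluster \<inter> hexagons = {hexagon_tile}"
    unfolding standard_cluster_def using hex sq tri disj by (auto simp: disjoint_iff)
  moreover have "standard_cluster \<inter> squares = {square_tile 0, square_tile 1, square_tile 2}"
    unfolding standard_cluster_def using hex sq tri disj by (auto simp: disjoint_iff)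
  moreover have "standard_cluster \<inter> triangles = {triangle_tile 1, triangle_tile 2}"
    unfolding standard_cluster_def using hex sq tri disj by (auto simp: disjoint_iff)
  ultimately have cards: "card (standard_cluster \<inter> hexagons) = 1"
    "card (standard_cluster \<inter> squares) = 3" "card (standard_cluster \<inter> triangles) = 2"
    using standard_cluster_distinct by auto
  have inj: "inj_on (\<lambda>(P, a::int, b::int). (+) (of_int a * period1 + of_int b * period2) ` P)
      (standard_cluster \<times> UNIV \<times> UNIV)"
    by (rule inj_onI) (use standard_cluster_inj in \<open>clarsimp; blast\<close>)
  have tiles: "tiles = {(+) p ` P | p P. p \<in> periods \<and> P \<in> standard_cluster}"
    unfolding tiles_def hexagons_def squares_eq triangles_eq standard_cluster_def by blast
  have "(\<lambda>(P, a::int, b::int). (+) (of_int a * period1 + of_int b * period2) ` P) `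
      (standard_cluster \<times> UNIV \<times> UNIV) = tiles"
    unfolding tiles periods_def by force
  then show ?thesis
    unfolding minimal_cluster_def bij_betw_def using cards inj by blast
qed

end

theory Submission
  imports Defs "HOL-Real_Asymp.Real_Asymp"
begin

text \<open>
  Every square has two triangle and two hexagon neighbours, and no tile has more neighbours than
  sides. So a chosen triangle has at most one chosen neighbour, a chosen square at most two and a
  chosen hexagon at most three. Let each chosen square send 13 to both adjacent triangles and 6 to
  both adjacent hexagons, and take back 4 from each chosen neighbour; it gives away at least
  \<open>2 * 13 + 2 * 6 - 2 * 4 = 30\<close>. Add 30 on every chosen triangle and hexagon. A triangle then holds
  at most \<open>30 + 13 - 4 = 3 * 13 = 39\<close> and a hexagon at most \<open>30 + 3 * (6 - 4) = 6 * 6 = 36\<close>, so on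
  average a cluster contains at most \<open>(2 * 39 + 36) / 30 = 19 / 5\<close> chosen tiles out of 6. Charge
  leaving a finite region is collected by tiles within a bounded number of clusters of it, which is
  negligible in the limit.
\<close>

section \<open>Edges and corners of tiles\<close>

text \<open>The hyperplane \<open>n \<bullet> z = c\<close> contains \<open>x\<close> and
  \<open>y\<close> and has all other vertices strictly on one side. So the affine hull of
  \<open>x\<close> and \<open>y\<close> misses the hull of the remaining vertices, which makes the
  segment a face.\<close>

lemma edge_of_hull_supporting:
  fixes V :: "'a::euclidean_space set"
  assumes "finite V" "x \<in> V" "y \<in> V" "x \<noteq> y"
    and "n \<bullet> x = c" "n \<bullet> y = c" and less: "\<And>v. v \<in> V - {x, y} \<Longrightarrow> n \<bullet> v < c"
  shows "convex hull {x, y} edge_of convex hull V"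
proof -
  have "affine hull {x, y} \<subseteq> {z. n \<bullet> z = c}"
    using assms by (intro hull_minimal affine_hyperplane) auto
  moreover have "convex hull (V - {x, y}) \<subseteq> {z. n \<bullet> z < c}"
    using less by (intro hull_minimal convex_halfspace_lt) auto
  ultimately have "affine hull {x, y} \<inter> convex hull (V - {x, y}) = {}"
    by fastforce
  then have "convex hull {x, y} face_of convex hull V"
    using assms by (intro face_of_convex_hulls) auto
  moreover have "aff_dim (convex hull {x, y}) = 1"
    using \<open>x \<noteq> y\<close> by (simp add: aff_dim_convex_hull aff_dim_2)
  ultimately show ?thesis by (simp add: edge_of_def)
qed

text \<open>By Krein-Milman, a compact convex edge is the hull of its extreme points; at most one of
  them would force dimension at most 0 instead of 1.\<close>

lemma edge_of_two_extreme_points: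
  fixes P :: "'a::euclidean_space set"
  assumes "compact P" "convex P" "e edge_of P"
  obtains x y where "x \<noteq> y" "x extreme_point_of e" "y extreme_point_of e"
proof -
  have f: "e face_of P" and d: "aff_dim e = 1" using assms(3) by (auto simp: edge_of_def)
  have "compact e" "convex e"
    using f assms face_of_imp_compact face_of_imp_convex by blast+
  then have e: "e = convex hull {x. x extreme_point_of e}"
    by (rule Krein_Milman_Minkowski)
  have "\<not> (\<exists>z. {x. x extreme_point_of e} \<subseteq> {z})"
  proof
    assume "\<exists>z. {x. x extreme_point_of e} \<subseteq> {z}"
    then obtain z where "{x. x extreme_point_of e} \<subseteq> {z}" by blast
    then have "aff_dim {x. x extreme_point_of e} \<le> aff_dim {z}" by (rule aff_dim_subset)
    with d e show False by (metis aff_dim_convex_hull aff_dim_sing not_one_le_zero)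
  qed
  then show ?thesis using that by blast
qed

lemma adjacent_tiles_sym: "adjacent_tiles P Q \<longleftrightarrow> adjacent_tiles Q P"
  unfolding adjacent_tiles_def by blast

lemma edge_of_translate:
  fixes P :: "'a::euclidean_space set"
  assumes "e edge_of P"
  shows "(+) p ` e edge_of (+) p ` P"
  using assms by (simp add: edge_of_def face_of_translation_eq aff_dim_translation_eq)

lemma adjacent_tiles_translate:
  assumes "adjacent_tiles P Q"
  shows "adjacent_tiles ((+) p ` P) ((+) p ` Q)"
proof -
  have "(+) p ` P \<noteq> (+) p ` Q"
    using assms unfolding adjacent_tiles_def by (simp add: inj_image_eq_iff)
  then show ?thesis
    using assms unfolding adjacent_tiles_def by (meson edge_of_translate)
qed

lemma tile_eq_translate:
  assumes "P \<in> tiles"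
  obtains a b :: int and R where "R \<in> standard_cluster"
    "P = (+) (of_int a * period1 + of_int b * period2) ` R"
proof -
  have "P \<in> (\<lambda>(P, a::int, b::int). (+) (of_int a * period1 + of_int b * period2) ` P) `
      (standard_cluster \<times> UNIV \<times> UNIV)"
    using assms minimal_cluster_standard unfolding minimal_cluster_def bij_betw_def by argo
  then show ?thesis using that by auto
qed

lemma compact_convex_tile:
  assumes "P \<in> tiles"
  shows "compact P" "convex P"
proof -
  obtain a b R where R: "R \<in> standard_cluster"
    and P: "P = (+) (of_int a * period1 + of_int b * period2) ` R"
    using tile_eq_translate[OF assms] .
  have "\<exists>V. finite V \<and> R = convex hull V"
    using R unfolding standard_cluster_def hexagon_tile_eq square_tile_eq triangle_tile_eq
    by (elim insertE emptyE) (rule exI, rule conjI[rotated], assumption, simp)+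
  then have "compact R" "convex R"
    by (auto simp: finite_imp_compact_convex_hull)
  then show "compact P" "convex P"
    unfolding P by (auto intro: compact_translation convex_translation)
qed

text \<open>Extreme points of a face are extreme in the whole tile, so the two ends of a common edge
  are common corners. This turns adjacency into a combinatorial condition.\<close>

lemma adjacent_tiles_share_corners:
  assumes "adjacent_tiles P Q" "P \<in> tiles"
  obtains x y where "x \<noteq> y" "{x, y} \<subseteq> corners P \<inter> corners Q"
proof -
  obtain e where e: "e edge_of P" "e edge_of Q"
    using assms(1) unfolding adjacent_tiles_def by blast
  obtain x y where xy: "x \<noteq> y" "x extreme_point_of e" "y extreme_point_of e"
    using edge_of_two_extreme_points[OF compact_convex_tile[OF assms(2)] e(1)] .
  have "{x, y} \<subseteq> corners P \<inter> corners Q"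
    using xy e extreme_point_of_face unfolding edge_of_def corners_def by blast
  with xy(1) show ?thesis by (rule that)
qed

section \<open>Integer codes for corners and neighbours\<close>

definition vertex :: "nat \<times> int \<times> int \<Rightarrow> complex" where
  "vertex = (\<lambda>(k, a, b). cis (real k * pi / 3) + of_int a * period1 + of_int b * period2)"

lemma vertex_eq:
  "vertex (0, a, b) = Complex 1 0 + of_int a * period1 + of_int b * period2"
  "vertex (1, a, b) = Complex (1/2) (sqrt 3/2) + of_int a * period1 + of_int b * period2"
  "vertex (2, a, b) = Complex (-(1/2)) (sqrt 3/2) + of_int a * period1 + of_int b * period2"
  "vertex (3, a, b) = Complex (-1) 0 + of_int a * period1 + of_int b * period2"
  "vertex (4, a, b) = Complex (-(1/2)) (-(sqrt 3/2)) + of_int a * period1 + of_int b * period2"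
  "vertex (5, a, b) = Complex (1/2) (-(sqrt 3/2)) + of_int a * period1 + of_int b * period2"
  unfolding vertex_def using cis_values by simp_all

lemma int_eq_0_if_small_multiple:
  fixes c d :: real and a :: int
  assumes "of_int a * c = d" "\<bar>d\<bar> < c"
  shows "a = 0"
proof (rule ccontr)
  assume "a \<noteq> 0"
  then have "1 \<le> \<bar>real_of_int a\<bar>" by linarith
  moreover have c: "c > 0" using assms(2) by linarith
  ultimately have "c \<le> \<bar>real_of_int a\<bar> * c" by simp
  also have "\<dots> = \<bar>d\<bar>" using assms(1) c by (metis abs_mult abs_of_pos)
  finally show False using assms(2) by simp
qed

text \<open>Corner offsets within a hexagon lie on the unit circle, so their coordinates differ by
  at most 2. This is less than the steps \<open>(sqrt 3 + 3) / 2\<close> and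
  \<open>1 + sqrt 3\<close> between hexagon centres, so equal vertices belong to the same
  hexagon.\<close>

lemma inj_on_vertex: "inj_on vertex ({..<6} \<times> UNIV)"
proof (rule inj_onI, clarify)
  fix k a b l c d
  assume k: "k < 6" "l < (6::nat)" and eq: "vertex (k, a, b) = vertex (l, c, d)"
  let ?v = "\<lambda>k. cis (real k * pi / 3)"
  have d: "of_int (a - c) * period1 + of_int (b - d) * period2 = ?v l - ?v k"
    using eq by (simp add: vertex_def algebra_simps)
  have le: "\<bar>f (?v l) - f (?v k)\<bar> \<le> 2" if "\<And>x. \<bar>f (cis x)\<bar> \<le> 1" for f :: "complex \<Rightarrow> real"
    using abs_triangle_ineq4[of "f (?v l)" "f (?v k)"] add_mono[OF that that]
    by (metis one_add_one order_trans)
  \<comment> \<open>\<open>period2\<close> is purely imaginary, so the real part isolates the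
    coefficient of \<open>period1\<close>; once that vanishes, the imaginary part isolates the
    other.\<close>
  have "of_int (a - c) * ((sqrt 3 + 3) / 2) = Re (?v l) - Re (?v k)"
    using arg_cong[OF d, of Re] by (simp add: period_eq)
  moreover have "\<bar>Re (?v l) - Re (?v k)\<bar> < (sqrt 3 + 3) / 2"
    using le[of Re] by (rule le_less_trans) simp_all
  ultimately have ac: "a - c = 0" by (rule int_eq_0_if_small_multiple)
  have "of_int (b - d) * (1 + sqrt 3) = Im (?v l) - Im (?v k)"
    using arg_cong[OF d, of Im] ac by (simp add: period_eq)
  moreover have "\<bar>Im (?v l) - Im (?v k)\<bar> < 1 + sqrt 3"
    using le[of Im] by (rule le_less_trans) simp_all
  ultimately have bd: "b - d = 0" by (rule int_eq_0_if_small_multiple)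
  have "vertex (k, 0, 0) = vertex (l, 0, 0)" using d ac bd by (simp add: vertex_def)
  then have "k = l"
    using less_6_cases[OF k(1)] less_6_cases[OF k(2)]
    by (elim insertE emptyE; simp add: vertex_eq[simplified] complex_eq_iff)
  then show "k = l \<and> (a, b) = (c, d)" using ac bd by simp
qed

text \<open>
  Every corner of the tiling lies on exactly one hexagon, so a triple \<open>(k, a, b)\<close> with \<open>k < 6\<close> names
  each corner uniquely, and finding tiles with common corners becomes integer arithmetic. The
  indices \<open>0\<close> to \<open>5\<close> stand for the hexagon, the three squares and the two triangles of the standard
  cluster.
\<close>

definition corner_codes :: "nat \<Rightarrow> (nat \<times> int \<times> int) set" where
  "corner_codes t =
     (if t = 0 then {(0, 0, 0), (1, 0, 0), (2, 0, 0), (3, 0, 0), (4, 0, 0), (5, 0, 0)}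
      else if t = 1 then {(0, 0, 0), (1, 0, 0), (3, 1, 0), (4, 1, 0)}
      else if t = 2 then {(1, 0, 0), (2, 0, 0), (4, 0, 1), (5, 0, 1)}
      else if t = 3 then {(2, 0, 0), (3, 0, 0), (5, -1, 1), (0, -1, 1)}
      else if t = 4 then {(1, 0, 0), (5, 0, 1), (3, 1, 0)}
      else {(2, 0, 0), (4, 0, 1), (0, -1, 1)})"

definition base_tile :: "nat \<Rightarrow> complex set" where
  "base_tile t = [hexagon_tile, square_tile 0, square_tile 1, square_tile 2,
     triangle_tile 1, triangle_tile 2] ! t"

lemma base_tile_simps:
  "base_tile 0 = hexagon_tile" "base_tile 1 = square_tile 0" "base_tile 2 = square_tile 1"
  "base_tile 3 = square_tile 2" "base_tile 4 = triangle_tile 1" "base_tile 5 = triangle_tile 2"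
  unfolding base_tile_def by simp_all

text \<open>The corners of the cluster's squares and triangles that are not on the central hexagon
  lie on the hexagons centred at \<open>period1\<close>, \<open>period2\<close> and
  \<open>period2 - period1\<close>.\<close>

lemma outer_corners_eq_vertex:
  "Complex 1 0 + Complex (sqrt 3/2) (1/2) = vertex (4, 1, 0)"
  "Complex (1/2) (sqrt 3/2) + Complex (sqrt 3/2) (1/2) = vertex (3, 1, 0)"
  "Complex (1/2) (sqrt 3/2) + Complex 0 1 = vertex (5, 0, 1)"
  "Complex (-(1/2)) (sqrt 3/2) + Complex 0 1 = vertex (4, 0, 1)"
  "Complex (-(1/2)) (sqrt 3/2) + Complex (-(sqrt 3/2)) (1/2) = vertex (0, -1, 1)"
  "Complex (-1) 0 + Complex (-(sqrt 3/2)) (1/2) = vertex (5, -1, 1)"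
  unfolding vertex_eq by (simp_all add: complex_eq_iff period_eq field_simps)

lemma inner_corners_eq_vertex:
  "Complex 1 0 = vertex (0, 0, 0)"
  "Complex (1/2) (sqrt 3/2) = vertex (1, 0, 0)"
  "Complex (-(1/2)) (sqrt 3/2) = vertex (2, 0, 0)"
  "Complex (-1) 0 = vertex (3, 0, 0)"
  "Complex (-(1/2)) (-(sqrt 3/2)) = vertex (4, 0, 0)"
  "Complex (1/2) (-(sqrt 3/2)) = vertex (5, 0, 0)"
  unfolding vertex_eq by simp_all

lemma corners_base_tile:
  assumes "t < 6"
  shows "corners (base_tile t) = vertex ` corner_codes t"
  using less_6_cases[OF assms]
  by (elim insertE emptyE; simp only: base_tile_simps corners_hexagon_tile
      corners_square_tile corners_triangle_tile outer_corners_eq_vertex;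
      simp add: corner_codes_def inner_corners_eq_vertex[simplified] insert_commute)

text \<open>A code \<open>(u, a, b)\<close> stands for base tile \<open>u\<close> moved by
  \<open>a\<close> times \<open>period1\<close> plus \<open>b\<close> times \<open>period2\<close>,
  as seen from the unmoved base tile \<open>t\<close>.\<close>

definition neighbour_codes :: "nat \<Rightarrow> (nat \<times> int \<times> int) set" where
  "neighbour_codes t =
     (if t = 0 then {(1, 0, 0), (1, -1, 0), (2, 0, 0), (2, 0, -1), (3, 0, 0), (3, 1, -1)}
      else if t = 1 then {(0, 0, 0), (0, 1, 0), (4, 0, 0), (5, 1, -1)}
      else if t = 2 then {(0, 0, 0), (0, 0, 1), (4, 0, 0), (5, 0, 0)}
      else if t = 3 then {(0, 0, 0), (0, -1, 1), (4, -1, 0), (5, 0, 0)}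
      else if t = 4 then {(1, 0, 0), (2, 0, 0), (3, 1, 0)}
      else {(1, -1, 1), (2, 0, 0), (3, 0, 0)})"

text \<open>\<open>(k, c - a, d - b)\<close> being a corner code of \<open>u\<close> means that tile
  \<open>u\<close>, moved by \<open>(a, b)\<close>, has the corner \<open>(k, c, d)\<close>.
  Matching one corner already fixes the offset, so a finite check suffices. The inserted code is the
  tile itself.\<close>

lemma shared_corner_codes:
  assumes "t < 6" "u < 6"
  shows "\<forall>(k, c, d) \<in> corner_codes t. \<forall>(k', c', d') \<in> corner_codes t.
    (k, c, d) \<noteq> (k', c', d') \<longrightarrow>
    (k, c - a, d - b) \<in> corner_codes u \<longrightarrow> (k', c' - a, d' - b) \<in> corner_codes u \<longrightarrow>
    (u, a, b) \<in> insert (t, 0, 0) (neighbour_codes t)"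
  using less_6_cases[OF assms(1)] less_6_cases[OF assms(2)]
  by (elim insertE emptyE; simp add: corner_codes_def neighbour_codes_def; auto)

lemma vertex_translate:
  "(of_int a * period1 + of_int b * period2) + vertex (k, c, d) = vertex (k, c + a, d + b)"
  by (simp add: vertex_def algebra_simps)

lemma corner_codes_less_6: "(k, c, d) \<in> corner_codes t \<Longrightarrow> k < 6"
  unfolding corner_codes_def by (auto split: if_splits)

lemma corners_translate_base_tile:
  assumes "t < 6" "x \<in> corners ((+) (of_int a * period1 + of_int b * period2) ` base_tile t)"
  obtains k c d where "x = vertex (k, c, d)" "(k, c - a, d - b) \<in> corner_codes t"
proof -
  obtain y where "y \<in> corner_codes t" "x = of_int a * period1 + of_int b * period2 + vertex y"
    using assms by (auto simp: corners_translate corners_base_tile)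
  moreover obtain k c d where "y = (k, c, d)" by (cases y)
  ultimately show ?thesis
    using that[of k "c + a" "d + b"] by (simp add: vertex_translate)
qed

lemma standard_cluster_base_tile:
  assumes "P \<in> standard_cluster"
  obtains t where "t < 6" "P = base_tile t"
proof -
  have "P \<in> base_tile ` {0, 1, 2, 3, 4, 5}"
    using assms unfolding standard_cluster_def image_insert base_tile_simps by simp
  then obtain t where "t \<in> {0, 1, 2, 3, 4, 5}" "P = base_tile t" by blast
  moreover from this have "t < 6" by auto
  ultimately show ?thesis using that by blast
qed

lemma neighbour_codes_card:
  assumes "t < 6"
  shows "finite (neighbour_codes t)" "card (neighbour_codes t) = card (corner_codes t)"
  using less_6_cases[OF assms] by (elim insertE emptyE; simp add: corner_codes_def neighbour_codes_def)+

text \<open>A neighbour shares two corners, hence its relative position occurs in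
  \<open>neighbour_codes\<close>, and that list has one entry per corner of the tile.\<close>

lemma tile_neighbours:
  assumes "P \<in> tiles"
  shows "finite {R \<in> tiles. adjacent_tiles P R}"
    and "card {R \<in> tiles. adjacent_tiles P R} \<le> card (corners P)"
proof -
  obtain a b P0 where P0: "P0 \<in> standard_cluster"
    and P: "P = (+) (of_int a * period1 + of_int b * period2) ` P0"
    using tile_eq_translate[OF assms] .
  obtain t where t: "t < 6" "P0 = base_tile t" using standard_cluster_base_tile[OF P0] .
  let ?f = "\<lambda>(u, c, d). (+) (of_int (a + c) * period1 + of_int (b + d) * period2) ` base_tile u"
  have sub: "{R \<in> tiles. adjacent_tiles P R} \<subseteq> ?f ` neighbour_codes t"
  proof
    fix R assume "R \<in> {R \<in> tiles. adjacent_tiles P R}"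
    then have R: "R \<in> tiles" and adj: "adjacent_tiles P R" by simp_all
    obtain a' b' R0 where R0: "R0 \<in> standard_cluster"
      and R_eq: "R = (+) (of_int a' * period1 + of_int b' * period2) ` R0"
      using tile_eq_translate[OF R] .
    obtain u where u: "u < 6" "R0 = base_tile u" using standard_cluster_base_tile[OF R0] .
    obtain x y where xy: "x \<noteq> y" "{x, y} \<subseteq> corners P \<inter> corners R"
      using adjacent_tiles_share_corners[OF adj assms] .
    \<comment> \<open>A shared corner gets one code from \<open>P\<close> and one from
      \<open>R\<close>; injectivity of \<open>vertex\<close> identifies the two.\<close>
    have code: "\<exists>k c d. z = vertex (k, c, d) \<and> (k, c - a, d - b) \<in> corner_codes t \<and>
        (k, c - a', d - b') \<in> corner_codes u" if "z \<in> {x, y}" for z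
    proof -
      have "z \<in> corners P" "z \<in> corners R" using xy(2) that by auto
      then obtain k c d k' c' d' where *: "z = vertex (k, c, d)" "(k, c - a, d - b) \<in> corner_codes t"
        "z = vertex (k', c', d')" "(k', c' - a', d' - b') \<in> corner_codes u"
        unfolding P R_eq t u using corners_translate_base_tile t(1) u(1) by metis
      moreover have "(k, c, d) = (k', c', d')"
        using * corner_codes_less_6 by (intro inj_onD[OF inj_on_vertex]) auto
      ultimately show ?thesis by blast
    qed
    obtain k c d where x: "x = vertex (k, c, d)" "(k, c - a, d - b) \<in> corner_codes t"
      "(k, c - a', d - b') \<in> corner_codes u" using code[of x] by blast
    obtain k' c' d' where y: "y = vertex (k', c', d')" "(k', c' - a, d' - b) \<in> corner_codes t"
      "(k', c' - a', d' - b') \<in> corner_codes u" using code[of y] by blast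
    have ne: "(k, c - a, d - b) \<noteq> (k', c' - a, d' - b)" using xy(1) x(1) y(1) by auto
    have "(u, a' - a, b' - b) \<in> insert (t, 0, 0) (neighbour_codes t)"
      using bspec[OF shared_corner_codes[OF t(1) u(1), of "a' - a" "b' - b"] x(2)] y(2) ne x(3) y(3)
      by auto
    \<comment> \<open>The code \<open>(t, 0, 0)\<close> would mean that \<open>R\<close> equals
      \<open>P\<close>.\<close>
    moreover have "(u, a' - a, b' - b) \<noteq> (t, 0, 0)"
      using adj unfolding P R_eq t u adjacent_tiles_def by auto
    ultimately have "(u, a' - a, b' - b) \<in> neighbour_codes t" by blast
    moreover have "R = ?f (u, a' - a, b' - b)"
      unfolding R_eq u prod.case by simp
    ultimately show "R \<in> ?f ` neighbour_codes t" by (rule rev_image_eqI)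
  qed
  then show "finite {R \<in> tiles. adjacent_tiles P R}"
    by (rule finite_subset) (simp add: neighbour_codes_card(1)[OF t(1)])
  have "card {R \<in> tiles. adjacent_tiles P R} \<le> card (neighbour_codes t)"
    using sub neighbour_codes_card(1)[OF t(1)] by (rule surj_card_le[rotated])
  also have "\<dots> = card (corner_codes t)" by (rule neighbour_codes_card(2)[OF t(1)])
  also have "\<dots> = card (vertex ` corner_codes t)"
    using corner_codes_less_6
    by (intro card_image[symmetric] inj_on_subset[OF inj_on_vertex]) auto
  also have "\<dots> = card (corners P)"
    unfolding P card_corners_translate t corners_base_tile[OF t(1)] ..
  finally show "card {R \<in> tiles. adjacent_tiles P R} \<le> card (corners P)" .
qed

section \<open>The neighbours of a square\<close>

text \<open>The line through \<open>x\<close> and \<open>y\<close> with normal \<open>n\<close>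
  separates the two polygons and touches each exactly in the segment, which is therefore an edge of
  both.\<close>

lemma adjacent_tiles_hullI:
  assumes "P \<noteq> Q" "P = convex hull V" "Q = convex hull W" "finite V" "finite W"
    and "{x, y} \<subseteq> V \<inter> W" "x \<noteq> y" "n \<bullet> y = n \<bullet> x"
    and V: "\<forall>v\<in>V. v = x \<or> v = y \<or> n \<bullet> x < n \<bullet> v" and W: "\<forall>w\<in>W. w = x \<or> w = y \<or> n \<bullet> w < n \<bullet> x"
  shows "adjacent_tiles P Q"
proof -
  have "convex hull {x, y} edge_of convex hull V"
  proof (rule edge_of_hull_supporting)
    show "- n \<bullet> x = - (n \<bullet> x)" "- n \<bullet> y = - (n \<bullet> x)" using assms by simp_all
    show "- n \<bullet> v < - (n \<bullet> x)" if "v \<in> V - {x, y}" for v using that V by auto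
  qed (use assms in auto)
  moreover have "convex hull {x, y} edge_of convex hull W"
  proof (rule edge_of_hull_supporting)
    show "n \<bullet> w < n \<bullet> x" if "w \<in> W - {x, y}" for w using that W by auto
  qed (use assms in auto)
  ultimately show ?thesis using assms(1-3) unfolding adjacent_tiles_def by blast
qed

lemma square_tile_neq:
  assumes "k < 6"
  shows "square_tile k \<noteq> hexagon_tile" "l < 6 \<Longrightarrow> square_tile k \<noteq> triangle_tile l"
proof -
  have p: "0 \<in> periods" by (rule periods_intro)
  have s: "square_tile k \<in> squares"
    unfolding squares_def using assms p self_translate by blast
  have h: "hexagon_tile \<in> hexagons"
    unfolding hexagons_def using p self_translate by blast
  show "square_tile k \<noteq> hexagon_tile"
    using tile_cards(2)[OF s] tile_cards(1)[OF h] by auto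
  assume "l < 6"
  then have "triangle_tile l \<in> triangles"
    unfolding triangles_def using p self_translate by blast
  from tile_cards(3)[OF this] show "square_tile k \<noteq> triangle_tile l"
    using tile_cards(2)[OF s] by auto
qed


text \<open>For square \<open>k\<close> the separating normal is the outer unit normal
  \<open>cis (k * pi / 3 + pi / 6)\<close> of the hexagon side from corner \<open>k\<close> to
  corner \<open>k + 1\<close>.\<close>

lemma square_hexagon_adjacent:
  "adjacent_tiles (square_tile 0) hexagon_tile"
  "adjacent_tiles (square_tile 1) hexagon_tile"
  "adjacent_tiles (square_tile 2) hexagon_tile"
  "adjacent_tiles (square_tile 3) hexagon_tile"
  "adjacent_tiles (square_tile 4) hexagon_tile"
  "adjacent_tiles (square_tile 5) hexagon_tile"
  subgoal
    by (rule adjacent_tiles_hullI[OF square_tile_neq(1) square_tile_eq(1) hexagon_tile_eq,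
          where x = "Complex 1 0" and y = "Complex (1/2) (sqrt 3/2)"
            and n = "Complex (sqrt 3/2) (1/2)"])
       (simp_all add: inner_complex_def Complex_eq_0 field_simps)
  subgoal
    by (rule adjacent_tiles_hullI[OF square_tile_neq(1) square_tile_eq(2) hexagon_tile_eq,
          where x = "Complex (1/2) (sqrt 3/2)" and y = "Complex (-(1/2)) (sqrt 3/2)"
            and n = "Complex 0 1"])
       (simp_all add: inner_complex_def Complex_eq_0 field_simps)
  subgoal
    by (rule adjacent_tiles_hullI[OF square_tile_neq(1) square_tile_eq(3) hexagon_tile_eq,
          where x = "Complex (-(1/2)) (sqrt 3/2)" and y = "Complex (-1) 0"
            and n = "Complex (-(sqrt 3/2)) (1/2)"])
       (simp_all add: inner_complex_def Complex_eq_0 field_simps)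
  subgoal
    by (rule adjacent_tiles_hullI[OF square_tile_neq(1) square_tile_eq(4) hexagon_tile_eq,
          where x = "Complex (-1) 0" and y = "Complex (-(1/2)) (-(sqrt 3/2))"
            and n = "Complex (-(sqrt 3/2)) (-(1/2))"])
       (simp_all add: inner_complex_def Complex_eq_0 field_simps)
  subgoal
    by (rule adjacent_tiles_hullI[OF square_tile_neq(1) square_tile_eq(5) hexagon_tile_eq,
          where x = "Complex (-(1/2)) (-(sqrt 3/2))" and y = "Complex (1/2) (-(sqrt 3/2))"
            and n = "Complex 0 (-1)"])
       (simp_all add: inner_complex_def Complex_eq_0 field_simps)
  subgoal
    by (rule adjacent_tiles_hullI[OF square_tile_neq(1) square_tile_eq(6) hexagon_tile_eq,
          where x = "Complex (1/2) (-(sqrt 3/2))" and y = "Complex 1 0"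
            and n = "Complex (sqrt 3/2) (-(1/2))"])
       (simp_all add: inner_complex_def Complex_eq_0 field_simps)
  done

text \<open>Square \<open>k\<close> lies between triangles \<open>k\<close> and
  \<open>k + 1\<close>. The normal is parallel to the hexagon side under the square and points from
  the triangle to the square.\<close>

lemma square_triangle_adjacent:
  "adjacent_tiles (square_tile 0) (triangle_tile 0)"
  "adjacent_tiles (square_tile 0) (triangle_tile 1)"
  "adjacent_tiles (square_tile 1) (triangle_tile 1)"
  "adjacent_tiles (square_tile 1) (triangle_tile 2)"
  "adjacent_tiles (square_tile 2) (triangle_tile 2)"
  "adjacent_tiles (square_tile 2) (triangle_tile 3)"
  subgoal
    by (rule adjacent_tiles_hullI[OF square_tile_neq(2) square_tile_eq(1) triangle_tile_eq(1),
          where x = "Complex 1 0" and y = "Complex 1 0 + Complex (sqrt 3/2) (1/2)"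
            and n = "Complex (-(1/2)) (sqrt 3/2)"])
       (simp_all add: inner_complex_def Complex_eq_0 field_simps)
  subgoal
    by (rule adjacent_tiles_hullI[OF square_tile_neq(2) square_tile_eq(1) triangle_tile_eq(2),
          where x = "Complex (1/2) (sqrt 3/2)" and y = "Complex (1/2) (sqrt 3/2) + Complex (sqrt 3/2) (1/2)"
            and n = "Complex (1/2) (-(sqrt 3/2))"])
       (simp_all add: inner_complex_def Complex_eq_0 field_simps)
  subgoal
    by (rule adjacent_tiles_hullI[OF square_tile_neq(2) square_tile_eq(2) triangle_tile_eq(2),
          where x = "Complex (1/2) (sqrt 3/2)" and y = "Complex (1/2) (sqrt 3/2) + Complex 0 1"
            and n = "Complex (-1) 0"])
       (simp_all add: inner_complex_def Complex_eq_0 field_simps)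
  subgoal
    by (rule adjacent_tiles_hullI[OF square_tile_neq(2) square_tile_eq(2) triangle_tile_eq(3),
          where x = "Complex (-(1/2)) (sqrt 3/2)" and y = "Complex (-(1/2)) (sqrt 3/2) + Complex 0 1"
            and n = "Complex 1 0"])
       (simp_all add: inner_complex_def Complex_eq_0 field_simps)
  subgoal
    by (rule adjacent_tiles_hullI[OF square_tile_neq(2) square_tile_eq(3) triangle_tile_eq(3),
          where x = "Complex (-(1/2)) (sqrt 3/2)" and y = "Complex (-(1/2)) (sqrt 3/2) + Complex (-(sqrt 3/2)) (1/2)"
            and n = "Complex (-(1/2)) (-(sqrt 3/2))"])
       (simp_all add: inner_complex_def Complex_eq_0 field_simps)
  subgoal
    by (rule adjacent_tiles_hullI[OF square_tile_neq(2) square_tile_eq(3) triangle_tile_eq(4),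
          where x = "Complex (-1) 0" and y = "Complex (-1) 0 + Complex (-(sqrt 3/2)) (1/2)"
            and n = "Complex (1/2) (sqrt 3/2)"])
       (simp_all add: inner_complex_def Complex_eq_0 field_simps)
  done

lemma translate_neq:
  assumes "card (corners P) > 0" "p \<noteq> 0"
  shows "(+) p ` P \<noteq> P"
  using centroid_translate[OF assms(1), of p] assms(2) by auto

text \<open>Each square has one triangle neighbour from each translation class, which later shows
  that its two triangles differ; \<open>p \<noteq> 0\<close> does the same for the hexagons.\<close>

lemma square_tile_neighbours:
  assumes "P \<in> {square_tile 0, square_tile 1, square_tile 2}"
  obtains p q r where "p \<in> periods" "q \<in> periods" "r \<in> periods" "p \<noteq> 0"
    "adjacent_tiles P hexagon_tile" "adjacent_tiles P ((+) p ` hexagon_tile)"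
    "adjacent_tiles P ((+) q ` triangle_tile 1)" "adjacent_tiles P ((+) r ` triangle_tile 2)"
proof -
  have per: "of_int a * period1 + of_int b * period2 \<in> periods" for a b
    unfolding periods_def by blast
  have per: "period1 \<in> periods" "period2 \<in> periods" "period2 - period1 \<in> periods"
    using per[of 1 0] per[of 0 1] per[of "-1" 1] by simp_all
  have ne: "period1 \<noteq> 0" "period2 \<noteq> 0" "period2 - period1 \<noteq> 0"
  proof -
    have "0 < sqrt 3" by simp
    then have "1 + sqrt 3 \<noteq> 0" "sqrt 3 + 3 \<noteq> 0"
      by (metis add_pos_pos less_irrefl zero_less_numeral zero_less_one)+
    then show "period1 \<noteq> 0" "period2 \<noteq> 0" "period2 - period1 \<noteq> 0"
      by (simp_all add: period_eq complex_eq_iff)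
  qed
  have untranslate: "adjacent_tiles R ((+) p ` S)" if "adjacent_tiles ((+) (- p) ` R) S" for R S p
    using adjacent_tiles_translate[OF that, of p] by (simp add: image_image)
  \<comment> \<open>The second hexagon comes from the opposite square: it is a translate of
    \<open>P\<close> and touches the central hexagon, so moving it onto \<open>P\<close> moves that
    hexagon to the far side.\<close>
  have hex: "adjacent_tiles (square_tile 0) ((+) period1 ` hexagon_tile)"
    "adjacent_tiles (square_tile 1) ((+) period2 ` hexagon_tile)"
    "adjacent_tiles (square_tile 2) ((+) (period2 - period1) ` hexagon_tile)"
    using square_hexagon_adjacent(4-6) unfolding tile_translates by (auto intro!: untranslate)
  note tri = square_triangle_adjacent[unfolded tile_translates]
  note zero = periods_intro(1)
  from assms consider "P = square_tile 0" | "P = square_tile 1" | "P = square_tile 2" by blast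
  then show ?thesis
  proof cases
    case 1
    then show ?thesis
      using that[OF per(1) zero periods_intro(4) ne(1)] square_hexagon_adjacent(1) hex(1) tri(1,2) by simp
  next
    case 2
    then show ?thesis
      using that[OF per(2) zero zero ne(2)] square_hexagon_adjacent(2) hex(2) tri(3,4) by simp
  next
    case 3
    then show ?thesis
      using that[OF per(3) periods_intro(2) zero ne(3)] square_hexagon_adjacent(3) hex(3) tri(5,6) by simp
  qed
qed

lemma tile_kind_iff:
  assumes "P \<in> tiles"
  shows "P \<in> hexagons \<longleftrightarrow> card (corners P) = 6" "P \<in> squares \<longleftrightarrow> card (corners P) = 4"
    "P \<in> triangles \<longleftrightarrow> card (corners P) = 3"
  using assms tile_cards[of P] unfolding tiles_def by auto

lemma square_neighbours:
  assumes "Q \<in> squares"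
  shows "2 \<le> card {R \<in> hexagons. adjacent_tiles Q R}"
    and "2 \<le> card {R \<in> triangles. adjacent_tiles Q R}"
proof -
  have "Q \<in> tiles" using assms by (simp add: tiles_def)
  note fin = tile_neighbours(1)[OF this]
  have two: "2 \<le> card {R \<in> X. adjacent_tiles Q R}"
    if "X \<subseteq> tiles" "R \<in> X" "R' \<in> X" "R \<noteq> R'" "adjacent_tiles Q R" "adjacent_tiles Q R'" for X R R'
  proof -
    have "card {R, R'} \<le> card {R \<in> X. adjacent_tiles Q R}"
      using that by (intro card_mono finite_subset[OF _ fin]) auto
    then show ?thesis using \<open>R \<noteq> R'\<close> by simp
  qed
  obtain s P where s: "s \<in> periods" and P: "P \<in> {square_tile 0, square_tile 1, square_tile 2}"
    and Q: "Q = (+) s ` P"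
    using assms unfolding squares_eq by blast
  obtain p q r where per: "p \<in> periods" "q \<in> periods" "r \<in> periods" and "p \<noteq> 0"
    and adj: "adjacent_tiles P hexagon_tile" "adjacent_tiles P ((+) p ` hexagon_tile)"
      "adjacent_tiles P ((+) q ` triangle_tile 1)" "adjacent_tiles P ((+) r ` triangle_tile 2)"
    using square_tile_neighbours[OF P] .
  note adj' = adj[THEN adjacent_tiles_translate[where p = s], folded Q]
  have comp: "(+) s ` (+) u ` A = (+) (s + u) ` A" for u and A :: "complex set"
    by (simp add: image_image add.assoc)
  have translate: "(+) t ` hexagon_tile \<in> hexagons" "(+) t ` triangle_tile 1 \<in> triangles"
    "(+) t ` triangle_tile 2 \<in> triangles" if "t \<in> periods" for t
    using that unfolding hexagons_def triangles_eq by blast+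
  have inj: "A = B" if "(+) s ` A = (+) s ` B" for A B
    using that by (simp add: inj_image_eq_iff)
  show "2 \<le> card {R \<in> hexagons. adjacent_tiles Q R}"
  proof (rule two[OF _ _ _ _ adj'(1,2)])
    show "(+) s ` hexagon_tile \<in> hexagons" "(+) s ` (+) p ` hexagon_tile \<in> hexagons"
      unfolding comp by (intro translate periods_add s per)+
    have "card (corners hexagon_tile) > 0" by (simp add: hexagon_tile_corners)
    from translate_neq[OF this \<open>p \<noteq> 0\<close>]
    show "(+) s ` hexagon_tile \<noteq> (+) s ` (+) p ` hexagon_tile"
      using inj by metis
  qed (auto simp: tiles_def)
  show "2 \<le> card {R \<in> triangles. adjacent_tiles Q R}"
  proof (rule two[OF _ _ _ _ adj'(3,4)])
    show "(+) s ` (+) q ` triangle_tile 1 \<in> triangles" "(+) s ` (+) r ` triangle_tile 2 \<in> triangles"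
      unfolding comp by (intro translate periods_add s per)+
    have "(+) q ` triangle_tile 1 \<noteq> (+) r ` triangle_tile 2"
      using per(2,3) standard_cluster_inj[of "triangle_tile 1" "triangle_tile 2"]
        standard_cluster_distinct(2) unfolding standard_cluster_def periods_def by blast
    then show "(+) s ` (+) q ` triangle_tile 1 \<noteq> (+) s ` (+) r ` triangle_tile 2"
      using inj by blast
  qed (auto simp: tiles_def)
qed

section \<open>Discharging\<close>

text \<open>
  The weights 13, 6 and 4 solve the dual of the linear program formed by the averaged local
  constraints.
\<close>

lemma charge_bound:
  fixes adj :: "'a \<Rightarrow> 'a \<Rightarrow> bool"
  assumes fin: "finite S" "finite T" "finite H" and sub: "S \<subseteq> T \<union> H \<union> A" and A: "A \<subseteq> S"
    and disj: "T \<inter> H = {}"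
    and square: "\<And>q. q \<in> A \<Longrightarrow> 2 \<le> card {t \<in> T. adj q t}" "\<And>q. q \<in> A \<Longrightarrow> 2 \<le> card {h \<in> H. adj q h}"
      "\<And>q. q \<in> A \<Longrightarrow> card {x \<in> S. adj q x} \<le> 2"
    and triangle: "\<And>t. t \<in> T \<Longrightarrow> card {q \<in> A. adj q t} \<le> 3"
      "\<And>t. t \<in> T \<inter> S \<Longrightarrow> card {q \<in> A. adj q t} \<le> 1"
    and hexagon: "\<And>h. h \<in> H \<Longrightarrow> card {q \<in> A. adj q h} \<le> 6"
      "\<And>h. h \<in> H \<inter> S \<Longrightarrow> card {q \<in> A. adj q h} \<le> 3"
  shows "30 * card S \<le> 39 * card T + 36 * card H"
proof -
  have finA: "finite A" using A fin(1) by (rule finite_subset)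
  \<comment> \<open>Double counting of the adjacent pairs between \<open>A\<close> and
    \<open>X\<close>.\<close>
  have swap: "(\<Sum>q\<in>A. card {x \<in> X. adj q x}) = (\<Sum>x\<in>X. card {q \<in> A. adj q x})" if "finite X" for X
    using sum.swap_restrict[OF finA that, of "\<lambda>_ _. 1::nat" adj] by simp
  let ?d = "\<lambda>x. card {q \<in> A. adj q x}"
  \<comment> \<open>Balance of one chosen square: it takes back at most 4 * 2, sends at least 13 * 2
    + 6 * 2, and thus loses at least 30.\<close>
  have "30 + 4 * card {t \<in> T \<inter> S. adj q t} + 4 * card {h \<in> H \<inter> S. adj q h}
      \<le> 13 * card {t \<in> T. adj q t} + 6 * card {h \<in> H. adj q h}" if "q \<in> A" for q
  proof -
    have "card {t \<in> T \<inter> S. adj q t} + card {h \<in> H \<inter> S. adj q h} =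
        card ({t \<in> T \<inter> S. adj q t} \<union> {h \<in> H \<inter> S. adj q h})"
      using fin disj by (intro card_Un_disjoint[symmetric]) auto
    also have "\<dots> \<le> card {x \<in> S. adj q x}"
      using fin(1) by (intro card_mono) auto
    also have "\<dots> \<le> 2" using square(3)[OF that] .
    finally show ?thesis using square(1,2)[OF that] by linarith
  qed
  then have "(\<Sum>q\<in>A. 30 + 4 * card {t \<in> T \<inter> S. adj q t} + 4 * card {h \<in> H \<inter> S. adj q h})
      \<le> (\<Sum>q\<in>A. 13 * card {t \<in> T. adj q t} + 6 * card {h \<in> H. adj q h})"
    by (rule sum_mono)
  then have charge: "30 * card A + 4 * sum ?d (T \<inter> S) + 4 * sum ?d (H \<inter> S) \<le> 13 * sum ?d T + 6 * sum ?d H"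
    unfolding sum.distrib sum_distrib_left[symmetric] swap[OF fin(2)] swap[OF fin(3)]
      swap[OF finite_Int[OF disjI1[OF fin(2)]]] swap[OF finite_Int[OF disjI1[OF fin(3)]]]
    by simp
  have split: "sum ?d X = sum ?d (X \<inter> S) + sum ?d (X - S)" "card X = card (X \<inter> S) + card (X - S)"
    if "finite X" for X
    using that by (auto intro: sum.Int_Diff card_Int_Diff)
  have le: "sum ?d X \<le> k * card X" if "\<And>x. x \<in> X \<Longrightarrow> ?d x \<le> k" for X k
    using sum_bounded_above[of X ?d k] that by (simp add: mult.commute)
  have "sum ?d (T \<inter> S) \<le> 1 * card (T \<inter> S)" "sum ?d (T - S) \<le> 3 * card (T - S)"
    "sum ?d (H \<inter> S) \<le> 3 * card (H \<inter> S)" "sum ?d (H - S) \<le> 6 * card (H - S)"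
    by (intro le; use triangle hexagon in auto)+
  moreover have "card S \<le> card (T \<inter> S) + card (H \<inter> S) + card A"
  proof -
    have "card S \<le> card (T \<inter> S \<union> H \<inter> S \<union> A)"
      using fin finA sub by (intro card_mono) auto
    also have "\<dots> \<le> card (T \<inter> S) + card (H \<inter> S) + card A"
      by (meson add_mono_thms_linordered_semiring(3) card_Un_le order_trans)
    finally show ?thesis .
  qed
  \<comment> \<open>Tiles in \<open>S\<close> receive net 9 per chosen adjacent square for triangles
    and 2 for hexagons; tiles outside \<open>S\<close> receive the full 13 and 6. With the degree
    bounds, 30 + 9 = 3 * 13 and 30 + 3 * 2 = 6 * 6.\<close>
  ultimately show ?thesis
    using charge split[OF fin(2)] split[OF fin(3)] by linarith
qed

text \<open>Enlarging \<open>V\<close> to \<open>W\<close> lets every chosen square see all its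
  triangles and hexagons, so no charge is lost at the boundary. The upper bounds survive there
  because degrees inside \<open>V\<close> are at most the degrees in the whole tiling.\<close>

lemma half_dependent_card_bound:
  assumes V: "V \<subseteq> tiles" and W: "finite W" "V \<subseteq> W" "W \<subseteq> tiles"
    and nbrs: "\<And>Q R. Q \<in> V \<Longrightarrow> R \<in> tiles \<Longrightarrow> adjacent_tiles Q R \<Longrightarrow> R \<in> W"
    and S: "half_dependent adjacent_tiles V S"
  shows "30 * card S \<le> 39 * card (W \<inter> triangles) + 36 * card (W \<inter> hexagons)"
proof (rule charge_bound)
  have SV: "S \<subseteq> V" using S unfolding half_dependent_def by blast
  have finV: "finite V" using W finite_subset by blast
  have deg: "card (neighbours adjacent_tiles V v) \<le> card (corners v)" if "v \<in> tiles" for v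
  proof -
    have "card (neighbours adjacent_tiles V v) \<le> card {R \<in> tiles. adjacent_tiles v R}"
      using V by (intro card_mono tile_neighbours(1) that) (auto simp: neighbours_def)
    then show ?thesis using tile_neighbours(2)[OF that] by linarith
  qed
  have half: "card {x \<in> S. adjacent_tiles v x} \<le> card (corners v) div 2" if "v \<in> S" for v
  proof -
    have "{x \<in> S. adjacent_tiles v x} = neighbours adjacent_tiles V v \<inter> S"
      using SV by (auto simp: neighbours_def)
    then have "card {x \<in> S. adjacent_tiles v x} \<le> card (neighbours adjacent_tiles V v) div 2"
      using S that unfolding half_dependent_def degree_in_def by auto
    also have "\<dots> \<le> card (corners v) div 2"
      using deg that SV V by (intro div_le_mono) blast
    finally show ?thesis .
  qed
  have finS: "finite S" using SV finV finite_subset by blast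
  have in_S: "card {q \<in> S \<inter> squares. adjacent_tiles q v} \<le> card {x \<in> S. adjacent_tiles v x}" for v
    using finS by (intro card_mono) (auto simp: adjacent_tiles_sym)
  have in_V: "card {x \<in> S. adjacent_tiles v x} \<le> card (neighbours adjacent_tiles V v)" for v
    using finV SV by (intro card_mono) (auto simp: neighbours_def)
  show "finite S" "finite (W \<inter> triangles)" "finite (W \<inter> hexagons)" "S \<inter> squares \<subseteq> S"
    using finS W by auto
  show "S \<subseteq> W \<inter> triangles \<union> W \<inter> hexagons \<union> S \<inter> squares"
    using SV W unfolding tiles_def by blast
  show "W \<inter> triangles \<inter> (W \<inter> hexagons) = {}"
    by (auto dest!: tile_cards)
  show "2 \<le> card {t \<in> W \<inter> triangles. adjacent_tiles q t}"
    "2 \<le> card {h \<in> W \<inter> hexagons. adjacent_tiles q h}"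
    "card {x \<in> S. adjacent_tiles q x} \<le> 2" if "q \<in> S \<inter> squares" for q
  proof -
    \<comment> \<open>All neighbours of a tile of \<open>V\<close> lie in \<open>W\<close>, so
      restricting to \<open>W\<close> removes nothing.\<close>
    have "{t \<in> W \<inter> triangles. adjacent_tiles q t} = {t \<in> triangles. adjacent_tiles q t}"
      "{h \<in> W \<inter> hexagons. adjacent_tiles q h} = {h \<in> hexagons. adjacent_tiles q h}"
      using nbrs[of q] that SV unfolding tiles_def by auto
    then show "2 \<le> card {t \<in> W \<inter> triangles. adjacent_tiles q t}"
      "2 \<le> card {h \<in> W \<inter> hexagons. adjacent_tiles q h}"
      using square_neighbours that by auto
    show "card {x \<in> S. adjacent_tiles q x} \<le> 2"
      using half[of q] that tile_cards(2)[of q] by simp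
  qed
  show "card {q \<in> S \<inter> squares. adjacent_tiles q t} \<le> 3" if "t \<in> W \<inter> triangles" for t
    using order_trans[OF in_S order_trans[OF in_V deg, of t]] that W(3) tile_cards(3)[of t] by auto
  show "card {q \<in> S \<inter> squares. adjacent_tiles q t} \<le> 1" if "t \<in> W \<inter> triangles \<inter> S" for t
    using order_trans[OF in_S half, of t] that tile_cards(3)[of t] by auto
  show "card {q \<in> S \<inter> squares. adjacent_tiles q h} \<le> 6" if "h \<in> W \<inter> hexagons" for h
    using order_trans[OF in_S order_trans[OF in_V deg, of h]] that W(3) tile_cards(1)[of h] by auto
  show "card {q \<in> S \<inter> squares. adjacent_tiles q h} \<le> 3" if "h \<in> W \<inter> hexagons \<inter> S" for h
    using order_trans[OF in_S half, of h] that tile_cards(1)[of h] by auto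
qed

section \<open>Regions of clusters\<close>

text \<open>A margin of \<open>K\<close> clusters on each side captures all neighbours of the
  region. By translation invariance \<open>K\<close> depends only on the neighbours of a single
  cluster, hence not on \<open>m\<close> and \<open>n\<close>.\<close>

lemma minimal_cluster_ratio_bound:
  assumes "minimal_cluster C v1 v2"
  shows "\<exists>K :: nat. \<forall>m>0. \<forall>n>0. half_dependence_ratio adjacent_tiles (cluster_region C v1 v2 m n)
      \<le> 19 / 30 * ((real m + 2 * real K) / real m) * ((real n + 2 * real K) / real n)"
proof -
  define g where "g = (\<lambda>(P, a::int, b::int). (+) (of_int a * v1 + of_int b * v2) ` P)"
  have cards: "card (C \<inter> hexagons) = 1" "card (C \<inter> squares) = 3" "card (C \<inter> triangles) = 2"
    and bij: "bij_betw g (C \<times> UNIV \<times> UNIV) tiles"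
    using assms unfolding minimal_cluster_def g_def by auto
  have g_tiles: "g (P, a, b) \<in> tiles" if "P \<in> C" for P a b
    using bij that by (auto dest: bij_betwE)
  have g_shift: "(+) (of_int c * v1 + of_int d * v2) ` g (P, a, b) = g (P, a + c, b + d)" for P a b c d
    by (simp add: g_def image_image algebra_simps)
  have g_corners: "card (corners (g (P, a, b))) = card (corners P)" for P a b
    by (simp add: g_def card_corners_translate)
  have C_tiles: "C \<subseteq> tiles"
    using g_tiles[of _ 0 0] by (auto simp: g_def)
  have C_eq: "C = (C \<inter> hexagons) \<union> (C \<inter> squares) \<union> (C \<inter> triangles)"
    using C_tiles unfolding tiles_def by blast
  have fins: "finite (C \<inter> hexagons)" "finite (C \<inter> squares)" "finite (C \<inter> triangles)"
    using cards by (auto intro: card_ge_0_finite)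
  have finC: "finite C" using C_eq fins by (metis finite_UnI)
  have "card C = card (C \<inter> hexagons) + card (C \<inter> squares) + card (C \<inter> triangles)"
    by (subst C_eq, subst card_Un_disjoint, use fins in \<open>auto dest!: tile_cards\<close>,
        subst card_Un_disjoint, use fins in \<open>auto dest!: tile_cards\<close>)
  then have cardC: "card C = 6" using cards by simp

  define M where "M = (\<Union>P\<in>C. {R \<in> tiles. adjacent_tiles P R})"
  have finM: "finite M"
    unfolding M_def using finC C_tiles tile_neighbours(1) by blast
  have "\<forall>R\<in>M. \<exists>a b. \<exists>P\<in>C. R = g (P, a, b)"
  proof
    fix R assume "R \<in> M"
    then have "R \<in> g ` (C \<times> UNIV \<times> UNIV)"
      using bij unfolding M_def bij_betw_def by blast
    then show "\<exists>a b. \<exists>P\<in>C. R = g (P, a, b)" by auto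
  qed
  then obtain \<alpha> \<beta> where coord: "\<And>R. R \<in> M \<Longrightarrow> \<exists>P\<in>C. R = g (P, \<alpha> R, \<beta> R)"
    by metis
  \<comment> \<open>A crude common bound: the sum of all absolute coordinates dominates each of
    them.\<close>
  define K where "K = nat (\<Sum>R\<in>M. \<bar>\<alpha> R\<bar> + \<bar>\<beta> R\<bar>)"
  have K: "\<bar>\<alpha> R\<bar> \<le> int K" "\<bar>\<beta> R\<bar> \<le> int K" if "R \<in> M" for R
  proof -
    have "\<bar>\<alpha> R\<bar> + \<bar>\<beta> R\<bar> \<le> (\<Sum>R\<in>M. \<bar>\<alpha> R\<bar> + \<bar>\<beta> R\<bar>)"
      using finM that by (intro member_le_sum) auto
    then show "\<bar>\<alpha> R\<bar> \<le> int K" "\<bar>\<beta> R\<bar> \<le> int K" unfolding K_def by linarith+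
  qed

  show ?thesis
  proof (intro exI[of _ K] allI impI)
    fix m n :: nat assume mn: "m > 0" "n > 0"
    define V where "V = cluster_region C v1 v2 m n"
    define I where "I = {- int K..<int m + int K}"
    define J where "J = {- int K..<int n + int K}"
    define W where "W = g ` (C \<times> I \<times> J)"
    have V_eq: "V = g ` (C \<times> {0..<int m} \<times> {0..<int n})"
    proof
      show "V \<subseteq> g ` (C \<times> {0..<int m} \<times> {0..<int n})"
      proof
        fix R assume "R \<in> V"
        then obtain P a b where "P \<in> C" "a < m" "b < n" "R = (+) (of_nat a * v1 + of_nat b * v2) ` P"
          unfolding V_def cluster_region_def by blast
        then show "R \<in> g ` (C \<times> {0..<int m} \<times> {0..<int n})"
          by (intro image_eqI[of _ _ "(P, int a, int b)"]) (auto simp: g_def)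
      qed
      show "g ` (C \<times> {0..<int m} \<times> {0..<int n}) \<subseteq> V"
      proof clarify
        fix P a b assume *: "P \<in> C" "a \<in> {0..<int m}" "b \<in> {0..<int n}"
        then have "g (P, a, b) = (+) (of_nat (nat a) * v1 + of_nat (nat b) * v2) ` P"
          "nat a < m" "nat b < n" by (auto simp: g_def)
        with *(1) show "g (P, a, b) \<in> V" unfolding V_def cluster_region_def by blast
      qed
    qed
    have inj: "inj_on g (C \<times> UNIV \<times> UNIV)" using bij by (rule bij_betw_imp_inj_on)
    have "card V = card (C \<times> {0..<int m} \<times> {0..<int n})"
      unfolding V_eq by (rule card_image) (rule inj_on_subset[OF inj], auto)
    then have cardV: "card V = 6 * m * n" by (simp add: card_cartesian_product cardC)
    have V_tiles: "V \<subseteq> tiles" and W_tiles: "W \<subseteq> tiles"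
      unfolding V_eq W_def using g_tiles by auto
    have VW: "V \<subseteq> W" unfolding V_eq W_def I_def J_def by (intro image_mono) auto
    have finW: "finite W" unfolding W_def I_def J_def using finC by simp
    have nbrs: "R \<in> W" if Q: "Q \<in> V" and R: "R \<in> tiles" and adj: "adjacent_tiles Q R" for Q R
    proof -
      obtain P a b where P: "P \<in> C" "a \<in> {0..<int m}" "b \<in> {0..<int n}" "Q = g (P, a, b)"
        using Q unfolding V_eq by auto
      have "R \<in> g ` (C \<times> UNIV \<times> UNIV)"
        using bij R unfolding bij_betw_def by blast
      then obtain P' a' b' where P': "P' \<in> C" "R = g (P', a', b')" by auto
      \<comment> \<open>Moving the cluster of \<open>Q\<close> back to the origin makes the
        translate of \<open>R\<close> a member of \<open>M\<close>.\<close>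
      have "adjacent_tiles (g (P, 0, 0)) (g (P', a' - a, b' - b))"
        using adjacent_tiles_translate[OF adj, of "of_int (- a) * v1 + of_int (- b) * v2"]
        unfolding P P' g_shift by simp
      moreover have "g (P, 0, 0) = P" by (simp add: g_def)
      ultimately have M: "g (P', a' - a, b' - b) \<in> M" (is "?R \<in> M")
        unfolding M_def using P(1) g_tiles[OF P'(1)] by auto
      obtain P'' where P'': "P'' \<in> C" "?R = g (P'', \<alpha> ?R, \<beta> ?R)" using coord[OF M] by blast
      \<comment> \<open>By injectivity of \<open>g\<close> the coordinates chosen by
        \<open>\<alpha>\<close> and \<open>\<beta>\<close> are the actual ones, so the bound
        \<open>K\<close> applies to them.\<close>
      have "(P', a' - a, b' - b) = (P'', \<alpha> ?R, \<beta> ?R)"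
        using P'(1) P'' by (intro inj_onD[OF inj]) auto
      then have "\<bar>a' - a\<bar> \<le> int K" "\<bar>b' - b\<bar> \<le> int K" using K[OF M] by auto
      then have "a' \<in> I" "b' \<in> J" unfolding I_def J_def using P(2,3) by auto
      then show "R \<in> W" unfolding W_def P' using P'(1) by blast
    qed
    have card_I: "card I = m + 2 * K" and card_J: "card J = n + 2 * K"
      unfolding I_def J_def card_atLeastLessThan_int by linarith+
    have count: "card (W \<inter> X) \<le> card (C \<inter> X) * ((m + 2 * K) * (n + 2 * K))"
      if "X \<in> {hexagons, triangles}" for X
    proof -
      \<comment> \<open>Translation by cluster vectors preserves the number of corners and therefore
        the kind of a tile.\<close>
      have "P \<in> X" if "P \<in> C" "g (P, a, b) \<in> X" for P a b
        using that \<open>X \<in> _\<close> tile_kind_iff[OF g_tiles[OF that(1)]] tile_kind_iff[of P] C_tiles g_corners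
        by auto
      then have "W \<inter> X \<subseteq> g ` ((C \<inter> X) \<times> I \<times> J)" unfolding W_def by auto
      then have "card (W \<inter> X) \<le> card ((C \<inter> X) \<times> I \<times> J)"
        by (rule surj_card_le[rotated]) (use finC in \<open>simp add: I_def J_def\<close>)
      also have "\<dots> = card (C \<inter> X) * ((m + 2 * K) * (n + 2 * K))"
        by (simp only: card_cartesian_product card_I card_J mult.assoc)
      finally show ?thesis .
    qed
    \<comment> \<open>Two triangles and one hexagon per cluster: 114 = 39 * 2 + 36 * 1. Dividing by
      30 and by the 6 tiles of a cluster later gives 19 / 30.\<close>
    have bound: "30 * card S \<le> 114 * ((m + 2 * K) * (n + 2 * K))"
      if "half_dependent adjacent_tiles V S" for S
    proof -
      have "30 * card S \<le> 39 * card (W \<inter> triangles) + 36 * card (W \<inter> hexagons)"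
        by (rule half_dependent_card_bound[OF V_tiles finW VW W_tiles _ that]) (rule nbrs)
      then show ?thesis using count[of triangles] count[of hexagons] cards by simp
    qed
    have finV: "finite V" using VW finW finite_subset by blast
    have "finite {S. half_dependent adjacent_tiles V S}"
      by (rule finite_subset[of _ "Pow V"]) (use finV in \<open>auto simp: half_dependent_def\<close>)
    moreover have "half_dependent adjacent_tiles V {}"
      by (simp add: half_dependent_def)
    ultimately have "Max (card ` {S. half_dependent adjacent_tiles V S})
        \<in> card ` {S. half_dependent adjacent_tiles V S}"
      by (intro Max_in) auto
    then have "30 * Max (card ` {S. half_dependent adjacent_tiles V S}) \<le> 114 * ((m + 2 * K) * (n + 2 * K))"
      using bound by auto
    then have "30 * real (Max (card ` {S. half_dependent adjacent_tiles V S}))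
        \<le> 114 * ((real m + 2 * real K) * (real n + 2 * real K))"
      by (simp flip: of_nat_le_iff[where ?'a = real])
    then show "half_dependence_ratio adjacent_tiles (cluster_region C v1 v2 m n)
      \<le> 19 / 30 * ((real m + 2 * real K) / real m) * ((real n + 2 * real K) / real n)"
      unfolding half_dependence_ratio_def V_def[symmetric] cardV
      using mn by (simp add: field_simps)
  qed
qed

section \<open>Passage to the limit\<close>

theorem theorem3p2:
  fixes C :: "complex set set" and v1 v2 :: complex
  assumes "minimal_cluster C v1 v2"
  shows "half_domination_density C v1 v2 \<le> ereal (19 / 30)"
proof -
  obtain K :: nat where K: "\<And>m n. m > 0 \<Longrightarrow> n > 0 \<Longrightarrow>
    half_dependence_ratio adjacent_tiles (cluster_region C v1 v2 m n)
      \<le> 19 / 30 * ((real m + 2 * real K) / real m) * ((real n + 2 * real K) / real n)"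
    using minimal_cluster_ratio_bound[OF assms] by blast
  define h where "h = (\<lambda>m::nat. (real m + 2 * real K) / real m)"
  have h: "h \<longlonglongrightarrow> 1" unfolding h_def by real_asymp
  let ?F = "sequentially \<times>\<^sub>F sequentially"
  have "((\<lambda>x. 19 / 30 * h (fst x) * h (snd x)) \<longlongrightarrow> 19 / 30 * 1 * 1) ?F"
    by (intro tendsto_intros filterlim_compose[OF h] filterlim_fst filterlim_snd)
  then have lim: "((\<lambda>x. ereal (19 / 30 * h (fst x) * h (snd x))) \<longlongrightarrow> ereal (19 / 30)) ?F"
    by simp
  have "eventually (\<lambda>x. fst x > 0 \<and> snd x > 0) ?F"
    unfolding eventually_prod_sequentially by (intro exI[of _ 1]) auto
  then have "eventually (\<lambda>x. (\<lambda>(m, n). ereal (half_dependence_ratio adjacent_tiles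
      (cluster_region C v1 v2 m n))) x \<le> ereal (19 / 30 * h (fst x) * h (snd x))) ?F"
    by (rule eventually_mono) (use K in \<open>auto simp: h_def\<close>)
  \<comment> \<open>The upper bound converges along the product filter, so its \<open>Limsup\<close>
    is simply its limit.\<close>
  then have "half_domination_density C v1 v2 \<le> Limsup ?F (\<lambda>x. ereal (19 / 30 * h (fst x) * h (snd x)))"
    unfolding half_domination_density_def by (rule Limsup_mono)
  also have "\<dots> = ereal (19 / 30)"
    using lim by (intro lim_imp_Limsup) (simp_all add: prod_filter_eq_bot)
  finally show ?thesis .
qed

end
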